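(* Let $\mathcal{A}\in\mathbb{R}^{[m,n]}$ be a nonsingular $M$-tensor and let $b\in\mathbb{R}^n$ with $b\ge 0$ be nonzero. Let $x_{\max}$ be the maximal nonnegative solution of $\mathcal{A}x^{m-1}=b$, and let $I_0=\{i\in[n]\mid b_i=0\}$. Let $\mathcal{A}=\mathcal{M}-\mathcal{N}$ be the level-1 splitting, $M$ the majorization matrix of $\mathcal{A}$, $M=P-Q$ with $P$ a nonsingular $M$-matrix and $Q\ge 0$, and let $\mathcal{L}$ be the associated nonnegative tensor with $\mathcal{L}x^{m-1}=Qx^{[m-1]}+\mathcal{N}x^{m-1}$. Let $x_0>0$ be any vector such that $\mathcal{A}x_0^{m-1}>0$ and $\mathcal{A}x_0^{m-1}\ge b$, and let $\{x_k\}$ be the sequence of nonnegative vectors given by $$P x_{k+1}^{[m-1]}=Q x_k^{[m-1]}+\mathcal{N}x_k^{m-1}+b,\qquad k\ge 0.$$ Then there is a smallest integer $k_0$ ($0\le k_0\le n-1$) such that $x_{k_0}$ and $x_{k_0+1}$ have the same zero pattern (including the case with no zero elements), and the $x_k$ have the same zero pattern for all $k\ge k_0$. Let $I=\{i\mid (x_{k_0})_i=0\}$ (which may be empty). Then $I\subseteq I_0$. Let $I_c=[n]\setminus I$. Then the iteration for $k\ge k_0$ is reduced to the iteration $$P_{I_c}\hat{x}_{k+1}^{[m-1]}=\mathcal{L}_{I_c}\hat{x}_k^{m-1}+b_{I_c},\quad k\ge k_0,\qquad \hat{x}_{k_0}=(x_{k_0})_{I_c},$$ for the lower-dimensional tensor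 equation $\mathcal{A}_{I_c}\hat{x}^{m-1}=b_{I_c}$; that is, $\hat{x}_k=(x_k)_{I_c}$ for all $k\ge k_0$. The maximal nonnegative solution $\hat{x}_{\max}$ of $\mathcal{A}_{I_c}\hat{x}^{m-1}=b_{I_c}$ equals $(x_{\max})_{I_c}$ (which is not necessarily positive). Thus $x_k$ converges to $x_{\max}$ linearly if and only if $\hat{x}_k$ converges to $\hat{x}_{\max}$ linearly. Write $\hat{\mathcal{A}}=\mathcal{A}_{I_c}$, $\hat{b}=b_{I_c}$, $\hat{P}=P_{I_c}$, $\hat{\mathcal{L}}=\mathcal{L}_{I_c}$ and $\hat{I}_0=I_0\cap I_c$, and assume that $\hat{x}_{\max}>0$. Then $\hat{x}_k$ converges to $\hat{x}_{\max}$ linearly under any of the following four conditions: 1. $\hat{P}^{-1}\hat{b}>0$. 2. $\hat{P}^{-1}\bar{\hat{\mathcal{L}}}e^{m-2}$ is irreducible, where $e$ is the vector of ones and $\bar{\hat{\mathcal{L}}}$ is the semi-symmetric tensor from $\hat{\mathcal{L}}$. 3. All diagonal elements of $\hat{\mathcal{A}}$ are included entirely in $\hat{P}$ (i.e. $\hat{P}$ has diagonal entries $a_{ii\ldots i}$, $i\in I_c$) and, with $\hat{\mathcal{B}}=\hat{\mathcal{D}}-\hat{\mathcal{A}}$ where $\hat{\mathcal{D}}$ is the diagonal part of $\hat{\mathcal{A}}$, the matrix $\bar{\hat{\mathcal{B}}}e^{m-2}$ is strictly upper or strictly lower triangular. 4. For each $i\in\hat{I}_0$, there is an element $a_{ii_2\ldots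 i_m}\ne 0$ with $i_2,\ldots,i_m\in I_c$, where $i_j\notin I_0$ for at least one $j$ ($2\le j\le m$).
   Context: $\mathbb{R}^{[m,n]}$ ($m\ge 2$, $n\ge 1$) is the set of real $m$th-order $n$-dimensional tensors $\mathcal{A}=(a_{i_1i_2\ldots i_m})$, $1\le i_1,\ldots,i_m\le n$; $[n]=\{1,\ldots,n\}$. For $x\in\mathbb{R}^n$, $\mathcal{A}x^{m-1}\in\mathbb{R}^n$ has entries $(\mathcal{A}x^{m-1})_i=\sum_{i_2,\ldots,i_m=1}^n a_{ii_2\ldots i_m}x_{i_2}\cdots x_{i_m}$, and $\mathcal{A}x^{m-2}\in\mathbb{R}^{n\times n}$ has entries $(\mathcal{A}x^{m-2})_{ij}=\sum_{i_3,\ldots,i_m=1}^n a_{iji_3\ldots i_m}x_{i_3}\cdots x_{i_m}$. Diagonal elements are $a_{ii\ldots i}$; the diagonal part of $\mathcal{A}$ keeps the diagonal elements and has zeros elsewhere. The semi-symmetric tensor $\bar{\mathcal{A}}$ from $\mathcal{A}$ has elements $\bar a_{i_1i_2\ldots i_m}=\frac{1}{(m-1)!}\sum a_{i_1j_2\ldots j_m}$, the sum being over all $(m-1)!$ permutations $j_2\ldots j_m$ of $i_2\ldots i_m$. Inequalities for vectors, matrices and tensors are entrywise. For $r>0$, $x^{[r]}$ is the entrywise power, $(x^{[r]})_i=(x_i)^r$. The identity tensor $\mathcal{I}$ has diagonal elements $1$ and all other elements $0$. A real $\lambda$ is an eigenvalue of $\mathcal{B}$ if $\mathcal{B}x^{m-1}=\lambda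 x^{[m-1]}$ for some $x\in\mathbb{R}^n\setminus\{0\}$; the spectral radius $\rho(\mathcal{B})$ is the maximum modulus of the eigenvalues. $\mathcal{A}$ is a nonsingular $M$-tensor if $\mathcal{A}=s\mathcal{I}-\mathcal{B}$ with $\mathcal{B}\ge 0$ and $s>\rho(\mathcal{B})$. A maximal nonnegative solution is a nonnegative solution $x$ with $x\ge y$ for every solution $y\ge 0$; it exists for a nonsingular $M$-tensor and $b\ge 0$. Level-1 splitting: $\mathcal{A}=\mathcal{M}-\mathcal{N}$, where $\mathcal{M}$ has elements $m_{ij\ldots j}=a_{ij\ldots j}$ for all $i,j\in[n]$ and all other elements zero. The majorization matrix $M$ of $\mathcal{A}$ has $(i,j)$ entry $a_{ij\ldots j}$, so $\mathcal{M}x^{m-1}=Mx^{[m-1]}$. A nonsingular $M$-matrix is a matrix $sI-B$ with $B\ge0$ and $s>\rho(B)$. The tensor $\mathcal{L}$ has elements $\mathcal{L}_{ij\ldots j}=Q_{ij}$ and coincides with $\mathcal{N}$ in all other positions. Explicitly, the iteration is $x_{k+1}=\left(P^{-1}(Qx_k^{[m-1]}+\mathcal{N}x_k^{m-1}+b)\right)^{[1/(m-1)]}$. For an index set $J\subseteq[n]$, $x_J$ is the subvector of $x$ with elements $x_i$, $i\in J$; $\mathcal{A}_J$ is the subtensor with elements $a_{i_1\ldots i_m}$, $i_1,\ldots,i_m\in J$; and $P_J$ is the principal submatrix with indices in $J$. The zero pattern of a vector is the set of indices of its zero elements. Linear convergence means at least linear convergence: $\{x_k\}$ converges linearly to $x_*$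 if there are constants $C>0$ and $r\in(0,1)$ with $\|x_k-x_*\|\le C r^k$ for all $k$. *)

theory Defs
  imports
    "HOL-Combinatorics.Permutations"
    "Jordan_Normal_Form.Spectral_Radius"
    "Jordan_Normal_Form.Gauss_Jordan_Elimination"
    "Jordan_Normal_Form.DL_Submatrix"
begin

text \<open>A real tensor of order \<open>m\<close> and dimension \<open>n\<close> is a function on index lists; only its values on
  lists of length \<open>m\<close> with entries below \<open>n\<close> are relevant, and tensor (in)equalities are always
  restricted to these lists.  Indices run through \<open>0, \<dots>, n - 1\<close>, as for library matrices.\<close>

type_synonym tensor = "nat list \<Rightarrow> real"

definition index_lists :: "nat \<Rightarrow> nat \<Rightarrow> nat list set" where
  "index_lists n k = {js. set js \<subseteq> {..<n} \<and> length js = k}"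

definition tensor_vec :: "nat \<Rightarrow> nat \<Rightarrow> tensor \<Rightarrow> real vec \<Rightarrow> real vec" where
  "tensor_vec m n A x =
     vec n (\<lambda>i. \<Sum>js\<in>index_lists n (m - 1). A (i # js) * (\<Prod>j\<leftarrow>js. x $ j))"

definition tensor_mat :: "nat \<Rightarrow> nat \<Rightarrow> tensor \<Rightarrow> real vec \<Rightarrow> real mat" where
  "tensor_mat m n A x =
     mat n n (\<lambda>(i, j). \<Sum>js\<in>index_lists n (m - 2). A (i # j # js) * (\<Prod>l\<leftarrow>js. x $ l))"

definition vec_pow :: "real vec \<Rightarrow> nat \<Rightarrow> real vec" where
  "vec_pow x r = map_vec (\<lambda>t. t ^ r) x"

definition ones_vec :: "nat \<Rightarrow> real vec" where
  "ones_vec n = vec n (\<lambda>_. 1)"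

text \<open>Strict entrywise comparison; the library's \<open><\<close> on vectors only means \<open>\<le>\<close> and \<open>\<noteq>\<close>.\<close>

definition vec_less :: "real vec \<Rightarrow> real vec \<Rightarrow> bool" where
  "vec_less x y \<longleftrightarrow> dim_vec x = dim_vec y \<and> (\<forall>i<dim_vec y. x $ i < y $ i)"

definition diagonal_index :: "nat list \<Rightarrow> bool" where
  "diagonal_index js \<longleftrightarrow> (\<exists>i. js = replicate (length js) i)"

definition identity_tensor :: tensor where
  "identity_tensor js = (if diagonal_index js then 1 else 0)"

definition diagonal_part :: "tensor \<Rightarrow> tensor" where
  "diagonal_part A js = (if diagonal_index js then A js else 0)"

definition nonneg_tensor :: "nat \<Rightarrow> nat \<Rightarrow> tensor \<Rightarrow> bool" where
  "nonneg_tensor m n B \<longleftrightarrow> (\<forall>js\<in>index_lists n m. 0 \<le> B js)"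

text \<open>The sum over all \<open>(m - 1)!\<close> permutations counts repeated index lists with multiplicity.\<close>

definition semi_symmetric :: "nat \<Rightarrow> tensor \<Rightarrow> tensor" where
  "semi_symmetric m A js =
     (\<Sum>\<pi> | \<pi> permutes {..<m - 1}. A (hd js # permute_list \<pi> (tl js))) / fact (m - 1)"

definition tensor_eigenvalue :: "nat \<Rightarrow> nat \<Rightarrow> tensor \<Rightarrow> real \<Rightarrow> bool" where
  "tensor_eigenvalue m n B \<mu> \<longleftrightarrow>
     (\<exists>x\<in>carrier_vec n. x \<noteq> 0\<^sub>v n \<and> tensor_vec m n B x = \<mu> \<cdot>\<^sub>v vec_pow x (m - 1))"

text \<open>\<open>Sup\<close> agrees with the maximum whenever the latter exists; unlike \<open>Max\<close> it is also the intended
  value without knowing that there are only finitely many eigenvalues.\<close>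

definition tensor_spectral_radius :: "nat \<Rightarrow> nat \<Rightarrow> tensor \<Rightarrow> real" where
  "tensor_spectral_radius m n B = Sup {\<bar>\<mu>\<bar> |\<mu>. tensor_eigenvalue m n B \<mu>}"

definition nonsingular_M_tensor :: "nat \<Rightarrow> nat \<Rightarrow> tensor \<Rightarrow> bool" where
  "nonsingular_M_tensor m n A \<longleftrightarrow>
     (\<exists>s B. nonneg_tensor m n B \<and> s > tensor_spectral_radius m n B \<and>
        (\<forall>js\<in>index_lists n m. A js = s * identity_tensor js - B js))"

definition nonsingular_M_matrix :: "nat \<Rightarrow> real mat \<Rightarrow> bool" where
  "nonsingular_M_matrix n P \<longleftrightarrow>
     (\<exists>s B. B \<in> carrier_mat n n \<and> 0\<^sub>m n n \<le> B \<and>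
        s > spectral_radius (map_mat complex_of_real B) \<and> P = s \<cdot>\<^sub>m 1\<^sub>m n - B)"

definition nonneg_solution :: "nat \<Rightarrow> nat \<Rightarrow> tensor \<Rightarrow> real vec \<Rightarrow> real vec \<Rightarrow> bool" where
  "nonneg_solution m n A b x \<longleftrightarrow> x \<in> carrier_vec n \<and> 0\<^sub>v n \<le> x \<and> tensor_vec m n A x = b"

definition maximal_nonneg_solution :: "nat \<Rightarrow> nat \<Rightarrow> tensor \<Rightarrow> real vec \<Rightarrow> real vec \<Rightarrow> bool" where
  "maximal_nonneg_solution m n A b x \<longleftrightarrow>
     nonneg_solution m n A b x \<and> (\<forall>y. nonneg_solution m n A b y \<longrightarrow> y \<le> x)"

definition level1_index :: "nat list \<Rightarrow> bool" where
  "level1_index js \<longleftrightarrow> (\<exists>j. tl js = replicate (length js - 1) j)"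

definition level1_M :: "tensor \<Rightarrow> tensor" where
  "level1_M A js = (if level1_index js then A js else 0)"

definition level1_N :: "tensor \<Rightarrow> tensor" where
  "level1_N A js = level1_M A js - A js"

definition majorization_mat :: "nat \<Rightarrow> nat \<Rightarrow> tensor \<Rightarrow> real mat" where
  "majorization_mat m n A = mat n n (\<lambda>(i, j). A (i # replicate (m - 1) j))"

definition level1_L :: "tensor \<Rightarrow> real mat \<Rightarrow> tensor" where
  "level1_L A Q js = (if level1_index js then Q $$ (js ! 0, js ! 1) else level1_N A js)"

text \<open>As in \<^const>\<open>submatrix\<close>, the selected entries are renumbered increasingly by \<^const>\<open>pick\<close>.\<close>

definition subvec :: "'a vec \<Rightarrow> nat set \<Rightarrow> 'a vec" where
  "subvec x J = vec (card {i. i < dim_vec x \<and> i \<in> J}) (\<lambda>i. x $ pick J i)"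

definition subtensor :: "tensor \<Rightarrow> nat set \<Rightarrow> tensor" where
  "subtensor A J js = A (map (pick J) js)"

definition zero_pattern :: "real vec \<Rightarrow> nat set" where
  "zero_pattern x = {i. i < dim_vec x \<and> x $ i = 0}"

definition vnorm :: "real vec \<Rightarrow> real" where
  "vnorm x = sqrt (x \<bullet> x)"

definition linearly_convergent_from :: "nat \<Rightarrow> (nat \<Rightarrow> real vec) \<Rightarrow> real vec \<Rightarrow> bool" where
  "linearly_convergent_from k0 x y \<longleftrightarrow>
     (\<exists>C r. C > 0 \<and> 0 < r \<and> r < 1 \<and> (\<forall>k\<ge>k0. vnorm (x k - y) \<le> C * r ^ k))"

definition irreducible_mat :: "real mat \<Rightarrow> bool" where
  "irreducible_mat A \<longleftrightarrow>
     \<not> (\<exists>S. S \<noteq> {} \<and> S \<subset> {..<dim_row A} \<and> (\<forall>i\<in>S. \<forall>j\<in>{..<dim_row A} - S. A $$ (i, j) = 0))"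

definition strictly_upper_triangular :: "real mat \<Rightarrow> bool" where
  "strictly_upper_triangular A \<longleftrightarrow> (\<forall>i<dim_row A. \<forall>j<dim_col A. j \<le> i \<longrightarrow> A $$ (i, j) = 0)"

definition strictly_lower_triangular :: "real mat \<Rightarrow> bool" where
  "strictly_lower_triangular A \<longleftrightarrow> (\<forall>i<dim_row A. \<forall>j<dim_col A. i \<le> j \<longrightarrow> A $$ (i, j) = 0)"

end

theory Submission
  imports Defs "HOL-Analysis.Convex" "HOL-Analysis.L2_Norm"
begin

text \<open>
  In the variables \<open>u = x^[m-1]\<close> the iteration reads \<open>P u' = F u + b\<close>, where \<open>F\<close> is built from weighted
  geometric means of the \<open>u\<^sub>j\<close> and is therefore monotone, concave and homogeneous of degree one.
  Inverse positivity of \<open>P\<close> makes the iterates decrease to the maximal solution, and the zero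
  pattern of an iterate determines that of the next one, so the patterns grow until they stabilise.
  On the remaining indices let \<open>H\<close> be the derivative of \<open>F\<close> at the limit \<open>v > 0\<close>.  Concavity (AM-GM)
  bounds the errors by \<open>P e' \<le> H e\<close>, and homogeneity gives \<open>(P - H) v = b \<ge> 0\<close>.  Hence
  \<open>P - H\<close> is a nonsingular \<open>M\<close>-matrix, and convergence is linear, unless some nonempty index set \<open>R\<close>
  with \<open>b\<^sub>R = 0\<close> is not linked to its complement by \<open>P\<close> and the tensor; each of the four conditions
  rules such an \<open>R\<close> out.
\<close>

section \<open>Inverse-positive matrices and tensor forms\<close>

text \<open>The obstacle is reducibility: neither \<open>P\<close> nor the tensor need be
  irreducible, so there is no Perron vector to measure errors with. Positive test vectors take its
  place. For a Z-matrix \<open>C\<close>, a vector \<open>u > 0\<close> with \<open>C u > 0\<close>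
  yields inverse positivity by a touching argument, restricts to principal submatrices, and turns a
  comparison of \<open>H\<close> with \<open>P\<close> into a contraction factor, namely a maximum
  of finitely many quotients. The limit offers only a weak test vector, because
  \<open>(P - H) v = b\<close> vanishes wherever \<open>b\<close> does; it has to be perturbed row
  by row, along links that lead to rows already positive. A set \<open>R\<close> as in the overview
  is precisely what blocks this: on \<open>R\<close> the fixed point equation is homogeneous and
  closed, so the linearised iteration fixes \<open>v\<close> restricted to \<open>R\<close> and has
  eigenvalue 1. On the nonlinear level the starting vector, with \<open>A x_0^(m-1) > 0\<close>,
  plays the role of the test vector: every nonnegative solution is compared with it by scaling. It
  keeps this property on principal subtensors, which is what makes the reduced equation
  accessible.\<close>

lemma finite_argmax:
  fixes f :: "nat \<Rightarrow> real"
  assumes "0 < n"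
  obtains l where "l < n" "\<And>j. j < n \<Longrightarrow> f j \<le> f l"
proof -
  have "Max (f ` {..<n}) \<in> f ` {..<n}"
    using assms by (intro Max_in) auto
  then obtain l where "l < n" "f l = Max (f ` {..<n})" by auto
  then show ?thesis using that by simp
qed

text \<open>For a Z-matrix the existence of such a \<open>u\<close> characterises nonsingular \<open>M\<close>-matrices; unlike the
  spectral radius it passes directly to principal submatrices.\<close>

definition semipositive_Z :: "nat \<Rightarrow> (nat \<Rightarrow> nat \<Rightarrow> real) \<Rightarrow> bool" where
  "semipositive_Z n P \<longleftrightarrow> (\<forall>i<n. \<forall>j<n. i \<noteq> j \<longrightarrow> P i j \<le> 0) \<and>
     (\<exists>u. \<forall>i<n. 0 < u i \<and> 0 < (\<Sum>j<n. P i j * u j))"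

text \<open>Touching argument: if \<open>v\<close> has a negative entry, let \<open>t > 0\<close> be
  the largest quotient \<open>- v j / u j\<close>. Then \<open>v + t u\<close> is nonnegative and
  vanishes at the maximiser \<open>l\<close>, so row \<open>l\<close> of \<open>P\<close> sends it
  to a value \<open>\<le> 0\<close> by the sign pattern, although \<open>P v \<ge> 0\<close> and
  \<open>P u > 0\<close>.\<close>

lemma semipositive_Z_nonneg:
  assumes P: "semipositive_Z n P" and Pv: "\<And>i. i < n \<Longrightarrow> 0 \<le> (\<Sum>j<n. P i j * v j)"
    and i: "i < n"
  shows "0 \<le> v i"
proof (rule ccontr)
  assume neg: "\<not> 0 \<le> v i"
  obtain u where u: "\<And>i. i < n \<Longrightarrow> 0 < u i" "\<And>i. i < n \<Longrightarrow> 0 < (\<Sum>j<n. P i j * u j)"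
    using P unfolding semipositive_Z_def by blast
  obtain l where l: "l < n" "\<And>j. j < n \<Longrightarrow> - v j / u j \<le> - v l / u l"
    using finite_argmax[of n "\<lambda>j. - v j / u j"] i by (metis gr_zeroI not_less0)
  define t where "t = - v l / u l"
  have "0 < - v i / u i" using neg u(1)[OF i] by (simp add: field_simps)
  then have t: "t > 0" using l(2)[OF i] by (simp add: t_def)
  have nonneg: "0 \<le> v j + t * u j" if "j < n" for j
  proof -
    have "- v j / u j \<le> t" using l(2)[OF that] by (simp add: t_def)
    then show ?thesis using u(1)[OF that] by (simp add: field_simps)
  qed
  have zero: "v l + t * u l = 0" using u(1)[OF l(1)] by (simp add: t_def)
  have "(\<Sum>j<n. P l j * (v j + t * u j)) \<le> 0"
  proof (rule sum_nonpos)
    fix j assume "j \<in> {..<n}"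
    then show "P l j * (v j + t * u j) \<le> 0"
      using P l(1) nonneg[of j] zero unfolding semipositive_Z_def
      by (cases "j = l") (auto intro: mult_nonpos_nonneg)
  qed
  moreover have "(\<Sum>j<n. P l j * (v j + t * u j)) = (\<Sum>j<n. P l j * v j) + t * (\<Sum>j<n. P l j * u j)"
    by (simp add: sum.distrib sum_distrib_left algebra_simps)
  ultimately show False using Pv[OF l(1)] u(2)[OF l(1)] t
    by (smt (verit) mult_pos_pos)
qed

lemma semipositive_Z_mono:
  assumes "semipositive_Z n P"
    and "\<And>i. i < n \<Longrightarrow> (\<Sum>j<n. P i j * v j) \<le> (\<Sum>j<n. P i j * w j)"
    and "i < n"
  shows "v i \<le> w i"
  using semipositive_Z_nonneg[OF assms(1), of "\<lambda>j. w j - v j" i] assms(2,3)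
  by (simp add: right_diff_distrib sum_subtractf)

lemma semipositive_Z_unique:
  assumes "semipositive_Z n P"
    and "\<And>i. i < n \<Longrightarrow> (\<Sum>j<n. P i j * v j) = (\<Sum>j<n. P i j * w j)"
    and "i < n"
  shows "v i = w i"
  using semipositive_Z_mono[OF assms(1), of v w i] semipositive_Z_mono[OF assms(1), of w v i]
    assms(2,3) by simp

lemma semipositive_Z_diag:
  assumes P: "semipositive_Z n P" and i: "i < n"
  shows "0 < P i i"
proof -
  obtain u where u: "\<And>i. i < n \<Longrightarrow> 0 < u i" "\<And>i. i < n \<Longrightarrow> 0 < (\<Sum>j<n. P i j * u j)"
    using P unfolding semipositive_Z_def by blast
  have "(\<Sum>j<n. P i j * u j) = P i i * u i + (\<Sum>j\<in>{..<n}-{i}. P i j * u j)"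
    using i by (subst sum.remove[of _ i]) auto
  moreover have "(\<Sum>j\<in>{..<n}-{i}. P i j * u j) \<le> 0"
    using P i less_imp_le[OF u(1)] unfolding semipositive_Z_def
    by (intro sum_nonpos) (auto intro!: mult_nonpos_nonneg)
  ultimately have "0 < P i i * u i" using u(2)[OF i] by linarith
  then show ?thesis using u(1)[OF i] by (simp add: zero_less_mult_iff)
qed

text \<open>Setting the entries of \<open>y\<close> in \<open>R\<close> to zero does not decrease \<open>P y\<close>, so \<open>y\<close> already vanishes there.\<close>

lemma semipositive_Z_block_zero:
  assumes P: "semipositive_Z n P"
    and y: "\<And>i. i < n \<Longrightarrow> 0 \<le> y i"
    and block: "\<And>i j. i \<in> R \<Longrightarrow> i < n \<Longrightarrow> j < n \<Longrightarrow> j \<notin> R \<Longrightarrow> P i j = 0"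
    and le: "\<And>i. i \<in> R \<Longrightarrow> i < n \<Longrightarrow> (\<Sum>j<n. P i j * y j) \<le> 0"
    and i: "i \<in> R" "i < n"
  shows "y i = 0"
proof -
  define y' where "y' = (\<lambda>j. if j \<in> R then 0 else y j)"
  have "(\<Sum>j<n. P i j * y j) \<le> (\<Sum>j<n. P i j * y' j)" if "i < n" for i
  proof (cases "i \<in> R")
    case True
    then have "(\<Sum>j<n. P i j * y' j) = 0"
      using block that by (intro sum.neutral) (auto simp: y'_def)
    then show ?thesis using le[OF True that] by simp
  next
    case False
    then show ?thesis
      using P that y unfolding semipositive_Z_def
      by (intro sum_mono) (auto simp: y'_def intro: mult_nonpos_nonneg)
  qed
  from semipositive_Z_mono[OF P this i(2)] have "y i \<le> 0" using i by (simp add: y'_def)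
  then show ?thesis using y[OF i(2)] by simp
qed

text \<open>Here and below \<open>k = m - 1\<close> is the degree of the form.\<close>

definition tensor_form :: "nat \<Rightarrow> nat \<Rightarrow> tensor \<Rightarrow> nat \<Rightarrow> (nat \<Rightarrow> real) \<Rightarrow> real" where
  "tensor_form n k A i f = (\<Sum>js\<in>index_lists n k. A (i # js) * (\<Prod>j\<leftarrow>js. f j))"

lemma finite_index_lists [simp]: "finite (index_lists n k)"
  unfolding index_lists_def by (rule finite_lists_length_eq) simp

lemma prod_list_nonneg_map:
  fixes f :: "'a \<Rightarrow> real"
  shows "(\<And>j. j \<in> set js \<Longrightarrow> 0 \<le> f j) \<Longrightarrow> 0 \<le> (\<Prod>j\<leftarrow>js. f j)"
  by (induction js) auto

lemma prod_list_pos_map: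
  fixes f :: "'a \<Rightarrow> real"
  shows "(\<And>j. j \<in> set js \<Longrightarrow> 0 < f j) \<Longrightarrow> 0 < (\<Prod>j\<leftarrow>js. f j)"
  by (induction js) auto

lemma prod_list_mono_map:
  fixes f g :: "'a \<Rightarrow> real"
  shows "(\<And>j. j \<in> set js \<Longrightarrow> 0 \<le> f j \<and> f j \<le> g j) \<Longrightarrow> (\<Prod>j\<leftarrow>js. f j) \<le> (\<Prod>j\<leftarrow>js. g j)"
proof (induction js)
  case (Cons a js)
  then show ?case by (auto intro!: mult_mono prod_list_nonneg_map intro: order_trans)
qed simp

lemma prod_list_mult_map:
  fixes f g :: "'a \<Rightarrow> real"
  shows "(\<Prod>j\<leftarrow>js. f j * g j) = (\<Prod>j\<leftarrow>js. f j) * (\<Prod>j\<leftarrow>js. g j)"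
  by (induction js) auto

lemma prod_list_const_map:
  fixes c :: real
  shows "(\<Prod>j\<leftarrow>js. c) = c ^ length js"
  by (induction js) auto

lemma index_lists_mem: "js \<in> index_lists n k \<Longrightarrow> j \<in> set js \<Longrightarrow> j < n"
  by (auto simp: index_lists_def)

lemma tensor_form_mono:
  assumes "\<And>js. js \<in> index_lists n k \<Longrightarrow> 0 \<le> L (i # js)"
    and "\<And>j. j < n \<Longrightarrow> 0 \<le> f j \<and> f j \<le> g j"
  shows "tensor_form n k L i f \<le> tensor_form n k L i g"
  unfolding tensor_form_def
  by (intro sum_mono mult_left_mono prod_list_mono_map) (auto simp: assms dest: index_lists_mem)

lemma tensor_form_nonneg:
  assumes "\<And>js. js \<in> index_lists n k \<Longrightarrow> 0 \<le> L (i # js)"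
    and "\<And>j. j < n \<Longrightarrow> 0 \<le> f j"
  shows "0 \<le> tensor_form n k L i f"
  unfolding tensor_form_def
  by (intro sum_nonneg mult_nonneg_nonneg prod_list_nonneg_map)
    (auto simp: assms dest: index_lists_mem)

lemma tensor_form_scale: "tensor_form n k L i (\<lambda>j. c * f j) = c ^ k * tensor_form n k L i f"
proof -
  have "L (i # js) * (\<Prod>j\<leftarrow>js. c * f j) = c ^ k * (L (i # js) * (\<Prod>j\<leftarrow>js. f j))"
    if "js \<in> index_lists n k" for js
    using that by (simp add: prod_list_mult_map prod_list_const_map index_lists_def)
  then show ?thesis unfolding tensor_form_def sum_distrib_left by (rule sum.cong[OF refl])
qed

lemma tensor_form_cong:
  assumes "\<And>js. js \<in> index_lists n k \<Longrightarrow> A (i # js) = B (i # js)"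
    and "\<And>j. j < n \<Longrightarrow> f j = g j"
  shows "tensor_form n k A i f = tensor_form n k B i g"
  unfolding tensor_form_def
  by (intro sum.cong refl arg_cong2[where f = "(*)"] arg_cong[where f = prod_list] map_cong)
    (auto simp: assms dest: index_lists_mem)

text \<open>Nonlinear version of the touching argument. With \<open>t\<close> the maximum of
  \<open>f j / g j\<close>, attained at \<open>l\<close>, the diagonal term at \<open>l\<close>
  scales exactly by \<open>t ^ k\<close> while the \<open>B\<close>-term of \<open>f\<close> is at
  most \<open>t ^ k\<close> times that of \<open>g\<close>. Hence \<open>t ^ k\<close> times the
  positive value of the form at \<open>g\<close> is at most its value at \<open>f\<close>, and
  \<open>le\<close> gives \<open>t \<le> 1\<close>.\<close>

lemma tensor_form_comparison:
  assumes k: "0 < k"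
    and B: "\<And>i js. i < n \<Longrightarrow> js \<in> index_lists n k \<Longrightarrow> 0 \<le> B (i # js)"
    and A: "\<And>i h. i < n \<Longrightarrow> tensor_form n k A i h = s * h i ^ k - tensor_form n k B i h"
    and g: "\<And>i. i < n \<Longrightarrow> 0 < g i \<and> 0 < tensor_form n k A i g"
    and f: "\<And>i. i < n \<Longrightarrow> 0 \<le> f i"
    and le: "\<And>i. i < n \<Longrightarrow> tensor_form n k A i f \<le> tensor_form n k A i g"
    and i: "i < n"
  shows "f i \<le> g i"
proof -
  obtain l where l: "l < n" "\<And>j. j < n \<Longrightarrow> f j / g j \<le> f l / g l"
    using finite_argmax[of n "\<lambda>j. f j / g j"] i by (metis gr_zeroI not_less0)
  define t where "t = f l / g l"
  have t: "f j \<le> t * g j" if "j < n" for j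
    using l(2)[OF that] g[OF that] by (simp add: t_def[symmetric] field_simps)
  have fl: "f l = t * g l" using g[OF l(1)] by (simp add: t_def)
  have t0: "0 \<le> t" using f[OF l(1)] g[OF l(1)] by (simp add: t_def)
  have "tensor_form n k B l f \<le> t ^ k * tensor_form n k B l g"
    using tensor_form_mono[of n k B l f "\<lambda>j. t * g j"] B l(1) f t
    by (simp add: tensor_form_scale)
  then have "t ^ k * tensor_form n k A l g \<le> tensor_form n k A l f"
    unfolding A[OF l(1)] fl power_mult_distrib by (simp add: algebra_simps)
  then have "t ^ k * tensor_form n k A l g \<le> 1 * tensor_form n k A l g" using le[OF l(1)] by simp
  then have "t ^ k \<le> 1" using g[OF l(1)] by (simp add: mult_le_cancel_right)
  then have "t \<le> 1" using t0 k by (metis one_less_power not_le)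
  then have "t * g i \<le> 1 * g i" using g[OF i] by (intro mult_right_mono) auto
  then show ?thesis using t[OF i] by simp
qed

section \<open>Linear convergence of the iteration\<close>

text \<open>AM-GM is applied to the powers \<open>r j ^ length js\<close>, so that taking the root
  returns the plain product.\<close>

lemma prod_list_arith_geom_mean:
  fixes r :: "'a \<Rightarrow> real"
  assumes js: "js \<noteq> []" and r: "\<And>j. j \<in> set js \<Longrightarrow> 0 \<le> r j"
  shows "(\<Prod>j\<leftarrow>js. r j) \<le> (\<Sum>j\<leftarrow>js. r j ^ length js) / length js"
proof -
  define k where "k = length js"
  have k: "k > 0" using js by (simp add: k_def)
  have r': "0 \<le> r (js ! l)" if "l < k" for l using that r by (simp add: k_def)
  have prod: "(\<Prod>j\<leftarrow>js. r j) = (\<Prod>l<k. r (js ! l))"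
    by (simp add: prod.list_conv_set_nth k_def atLeast0LessThan)
  have sum: "(\<Sum>j\<leftarrow>js. r j ^ k) = (\<Sum>l<k. r (js ! l) ^ k)"
    by (simp add: sum_list_sum_nth k_def atLeast0LessThan)
  have nonneg: "0 \<le> (\<Prod>l<k. r (js ! l))" using r' by (intro prod_nonneg) auto
  \<comment> \<open>The root is expressed by \<open>powr\<close>, whose power laws are used for a
    positive base; a zero product is therefore treated apart.\<close>
  have "(\<Prod>l<k. r (js ! l)) = ((\<Prod>l<k. r (js ! l)) ^ k) powr (1 / k)"
  proof (cases "(\<Prod>l<k. r (js ! l)) = 0")
    case True
    with k show ?thesis unfolding True by simp
  next
    case False
    then have "0 < (\<Prod>l<k. r (js ! l))" using nonneg by linarith
    then show ?thesis using k by (simp add: powr_powr flip: powr_realpow)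
  qed
  also have "\<dots> = (\<Prod>l<k. r (js ! l) ^ k) powr (1 / card {..<k})"
    by (simp add: prod_power_distrib)
  also have "\<dots> \<le> (\<Sum>l<k. r (js ! l) ^ k / card {..<k})"
    using k r' by (intro arith_geom_mean) auto
  finally show ?thesis by (simp add: prod sum flip: k_def sum_divide_distrib)
qed

text \<open>AM-GM for the ratios \<open>x j / z j\<close>. In the variables \<open>x j ^ k\<close>
  the left side is a geometric mean and the right side its tangent at \<open>z\<close>, with
  equality for \<open>x = z\<close>.\<close>

lemma prod_list_tangent:
  fixes x z :: "'a \<Rightarrow> real"
  assumes js: "length js = k" "0 < k"
    and xz: "\<And>j. j \<in> set js \<Longrightarrow> 0 \<le> x j \<and> 0 < z j"
  shows "(\<Prod>j\<leftarrow>js. x j) \<le> (\<Prod>j\<leftarrow>js. z j) * ((\<Sum>j\<leftarrow>js. x j ^ k / z j ^ k) / k)"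
proof -
  have "map x js = map (\<lambda>j. z j * (x j / z j)) js"
    using xz by (intro map_cong) (auto simp: less_le)
  then have "(\<Prod>j\<leftarrow>js. x j) = (\<Prod>j\<leftarrow>js. z j) * (\<Prod>j\<leftarrow>js. x j / z j)"
    by (metis prod_list_mult_map)
  also have "\<dots> \<le> (\<Prod>j\<leftarrow>js. z j) * ((\<Sum>j\<leftarrow>js. (x j / z j) ^ k) / k)"
    using prod_list_arith_geom_mean[of js "\<lambda>j. x j / z j"] js xz
    by (intro mult_left_mono prod_list_nonneg_map) (auto simp: less_imp_le)
  finally show ?thesis by (simp add: power_divide)
qed

lemma sum_list_count:
  fixes g :: "nat \<Rightarrow> real"
  assumes "set js \<subseteq> {..<n}"
  shows "(\<Sum>j\<leftarrow>js. g j) = (\<Sum>j<n. real (count_list js j) * g j)"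
  using assms
proof (induction js)
  case (Cons a js)
  have "(\<Sum>j<n. real (count_list (a # js) j) * g j) = (\<Sum>j<n. real (count_list js j) * g j + (if j = a then g j else 0))"
    by (intro sum.cong) (auto simp: algebra_simps)
  then show ?case using Cons by (simp add: sum.distrib sum.delta)
qed simp

text \<open>The derivative of \<open>u \<mapsto> L x^k\<close>, \<open>x = u^[1/k]\<close>, at \<open>u = z^[k]\<close>.\<close>

definition tensor_jac :: "nat \<Rightarrow> nat \<Rightarrow> tensor \<Rightarrow> (nat \<Rightarrow> real) \<Rightarrow> nat \<Rightarrow> nat \<Rightarrow> real" where
  "tensor_jac n k L z i j =
     (\<Sum>js\<in>index_lists n k. L (i # js) * (\<Prod>l\<leftarrow>js. z l) * real (count_list js j) / (k * z j ^ k))"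

text \<open>Exchanging the sums collects the contribution of each index list, with multiplicities,
  in exactly the shape of the AM-GM bound.\<close>

lemma tensor_jac_sum:
  "(\<Sum>j<n. tensor_jac n k L z i j * y j) =
     (\<Sum>js\<in>index_lists n k. L (i # js) * ((\<Prod>l\<leftarrow>js. z l) * ((\<Sum>j\<leftarrow>js. y j / z j ^ k) / k)))"
proof -
  have "(\<Sum>j<n. tensor_jac n k L z i j * y j) =
      (\<Sum>js\<in>index_lists n k. \<Sum>j<n. L (i # js) * (\<Prod>l\<leftarrow>js. z l) * real (count_list js j) / (k * z j ^ k) * y j)"
    unfolding tensor_jac_def sum_distrib_right by (rule sum.swap)
  also have "\<dots> = (\<Sum>js\<in>index_lists n k. L (i # js) * ((\<Prod>l\<leftarrow>js. z l) * ((\<Sum>j\<leftarrow>js. y j / z j ^ k) / k)))"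
  proof (rule sum.cong[OF refl])
    fix js assume "js \<in> index_lists n k"
    then have "set js \<subseteq> {..<n}" by (simp add: index_lists_def)
    from sum_list_count[OF this, of "\<lambda>j. y j / z j ^ k"]
    show "(\<Sum>j<n. L (i # js) * (\<Prod>l\<leftarrow>js. z l) * real (count_list js j) / (k * z j ^ k) * y j) =
      L (i # js) * ((\<Prod>l\<leftarrow>js. z l) * ((\<Sum>j\<leftarrow>js. y j / z j ^ k) / k))"
      by (simp add: sum_distrib_left sum_divide_distrib field_simps)
  qed
  finally show ?thesis .
qed

text \<open>Euler's identity: as a function of \<open>z j ^ k\<close> the form is homogeneous of
  degree one.\<close>

lemma tensor_jac_self:
  assumes k: "0 < k" and z: "\<And>j. j < n \<Longrightarrow> 0 < z j"
  shows "(\<Sum>j<n. tensor_jac n k L z i j * z j ^ k) = tensor_form n k L i z"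
  unfolding tensor_jac_sum tensor_form_def
proof (rule sum.cong[OF refl])
  fix js assume js: "js \<in> index_lists n k"
  have "map (\<lambda>j. z j ^ k / z j ^ k) js = map (\<lambda>_. 1) js"
  proof (rule map_cong[OF refl])
    fix j assume "j \<in> set js"
    then have "z j \<noteq> 0" using z[OF index_lists_mem[OF js]] by (simp add: less_imp_neq[THEN not_sym])
    then show "z j ^ k / z j ^ k = 1" by simp
  qed
  then have "(\<Sum>j\<leftarrow>js. z j ^ k / z j ^ k) = (\<Sum>j\<leftarrow>js. 1)" by (rule arg_cong)
  also have "\<dots> = real k"
    using js by (simp add: sum_list_triv index_lists_def)
  finally have "(\<Sum>j\<leftarrow>js. z j ^ k / z j ^ k) = real k" .
  then show "L (i # js) * ((\<Prod>l\<leftarrow>js. z l) * ((\<Sum>j\<leftarrow>js. z j ^ k / z j ^ k) / k)) = L (i # js) * (\<Prod>j\<leftarrow>js. z j)"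
    using k by simp
qed

text \<open>A concave function lies below its tangent; by Euler's identity the tangent has no
  constant term. The inequality holds for each index list separately.\<close>

lemma tensor_form_tangent:
  assumes k: "0 < k" and L: "\<And>js. js \<in> index_lists n k \<Longrightarrow> 0 \<le> L (i # js)"
    and xz: "\<And>j. j < n \<Longrightarrow> 0 \<le> x j \<and> 0 < z j"
  shows "tensor_form n k L i x \<le> (\<Sum>j<n. tensor_jac n k L z i j * x j ^ k)"
  unfolding tensor_jac_sum tensor_form_def
proof (rule sum_mono, rule mult_left_mono)
  fix js assume js: "js \<in> index_lists n k"
  then show "0 \<le> L (i # js)" by (rule L)
  show "(\<Prod>j\<leftarrow>js. x j) \<le> (\<Prod>l\<leftarrow>js. z l) * ((\<Sum>j\<leftarrow>js. x j ^ k / z j ^ k) / k)"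
    using js k xz index_lists_mem[OF js] by (intro prod_list_tangent) (auto simp: index_lists_def)
qed

lemma tensor_jac_nonneg:
  assumes L: "\<And>js. js \<in> index_lists n k \<Longrightarrow> 0 \<le> L (i # js)"
    and z: "\<And>j. j < n \<Longrightarrow> 0 < z j" and "j < n"
  shows "0 \<le> tensor_jac n k L z i j"
  unfolding tensor_jac_def
proof (rule sum_nonneg)
  fix js assume js: "js \<in> index_lists n k"
  have "0 \<le> (\<Prod>l\<leftarrow>js. z l)"
    by (rule prod_list_nonneg_map) (rule less_imp_le[OF z[OF index_lists_mem[OF js]]])
  then show "0 \<le> L (i # js) * (\<Prod>l\<leftarrow>js. z l) * real (count_list js j) / (real k * z j ^ k)"
    using L[OF js] z[OF \<open>j < n\<close>] by simp
qed

text \<open>An entry of the derivative is a sum of nonnegative terms with positive weights on the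
  lists through \<open>j\<close>, so a zero entry can be read back as missing tensor
  elements.\<close>

lemma tensor_jac_eq_0D:
  assumes L: "\<And>js. js \<in> index_lists n k \<Longrightarrow> 0 \<le> L (i # js)"
    and z: "\<And>j. j < n \<Longrightarrow> 0 < z j" and "j < n"
    and zero: "tensor_jac n k L z i j = 0" and js: "js \<in> index_lists n k" "j \<in> set js"
  shows "L (i # js) = 0"
proof -
  have pos: "0 < (\<Prod>l\<leftarrow>js. z l)" if "js \<in> index_lists n k" for js
    by (rule prod_list_pos_map) (rule z[OF index_lists_mem[OF that]])
  have "0 \<le> L (i # js) * (\<Prod>l\<leftarrow>js. z l) * real (count_list js j) / (k * z j ^ k)"
    if "js \<in> index_lists n k" for js
    using L[OF that] pos[OF that] z[OF \<open>j < n\<close>]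
    by (intro divide_nonneg_nonneg mult_nonneg_nonneg) auto
  with zero js have "L (i # js) * (\<Prod>l\<leftarrow>js. z l) * real (count_list js j) / (k * z j ^ k) = 0"
    unfolding tensor_jac_def by (subst (asm) sum_nonneg_eq_0_iff) auto
  moreover have "k \<noteq> 0" "count_list js j \<noteq> 0"
    using js by (auto simp: index_lists_def count_list_0_iff)
  moreover have "(\<Prod>l\<leftarrow>js. z l) \<noteq> 0" "z j \<noteq> 0" using pos[OF js(1)] z[OF \<open>j < n\<close>] by linarith+
  ultimately show ?thesis by (simp del: prod_list_zero_iff)
qed

text \<open>Among the admissible \<open>v > 0\<close> take one with the most strictly positive rows of \<open>C v\<close>.  If some row is
  not strictly positive, \<open>chain\<close> links such a row \<open>i\<close> to a strictly positive row \<open>j\<close>, and lowering \<open>v\<^sub>j\<close>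
  slightly makes row \<open>i\<close> strictly positive as well.\<close>

lemma semipositive_Z_chained:
  assumes Z: "\<And>i j. i < n \<Longrightarrow> j < n \<Longrightarrow> i \<noteq> j \<Longrightarrow> C i j \<le> 0"
    and u: "\<And>i. i < n \<Longrightarrow> 0 < u i" "\<And>i. i < n \<Longrightarrow> 0 \<le> (\<Sum>j<n. C i j * u j)"
    and chain: "\<And>R. R \<subseteq> {..<n} \<Longrightarrow> R \<noteq> {} \<Longrightarrow> (\<And>i. i \<in> R \<Longrightarrow> (\<Sum>j<n. C i j * u j) = 0) \<Longrightarrow>
        (\<And>i j. i \<in> R \<Longrightarrow> j < n \<Longrightarrow> j \<notin> R \<Longrightarrow> C i j = 0) \<Longrightarrow> False"
  shows "semipositive_Z n C"
proof -
  define app where "app v i = (\<Sum>j<n. C i j * v j)" for v i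
  \<comment> \<open>The last conjunct keeps every row that is positive for \<open>u\<close>
    positive. A row outside \<open>S v\<close> then satisfies \<open>app u i = 0\<close>, which is
    the form in which \<open>chain\<close> asks for it.\<close>
  define good where "good v \<longleftrightarrow> (\<forall>i<n. 0 < v i \<and> 0 \<le> app v i \<and> (0 < app u i \<longrightarrow> 0 < app v i))" for v
  define S where "S v = {i. i < n \<and> 0 < app v i}" for v
  have fin: "finite (S v)" for v by (simp add: S_def)
  have "good u" using u by (simp add: good_def app_def)
  moreover have "\<forall>v. good v \<longrightarrow> card (S v) < Suc n"
    using card_mono[of "{..<n}" "S _"] by (auto simp: S_def less_Suc_eq_le)
  ultimately have "\<exists>v. good v \<and> (\<forall>w. good w \<longrightarrow> card (S w) \<le> card (S v))"
    by (rule Lattices_Big.ex_has_greatest_nat)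
  then obtain v where v: "good v" and max: "\<And>w. good w \<Longrightarrow> card (S w) \<le> card (S v)"
    by auto
  have "S v = {..<n}"
  proof (rule ccontr)
    assume "S v \<noteq> {..<n}"
    then have "{..<n} - S v \<noteq> {}" by (auto simp: S_def)
    moreover have "(\<Sum>j<n. C i j * u j) = 0" if "i \<in> {..<n} - S v" for i
    proof -
      have "i < n" "\<not> 0 < app v i" using that by (auto simp: S_def)
      then have "\<not> 0 < app u i" using v unfolding good_def by blast
      then show ?thesis using u(2)[OF \<open>i < n\<close>] by (simp add: app_def)
    qed
    ultimately have "\<not> (\<forall>i j. i \<in> {..<n} - S v \<longrightarrow> j < n \<longrightarrow> j \<notin> {..<n} - S v \<longrightarrow> C i j = 0)"
      using chain[of "{..<n} - S v"] by blast
    then obtain i j where ij: "i < n" "i \<notin> S v" "j < n" "j \<in> S v" "C i j \<noteq> 0"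
      by blast
    then have "i \<noteq> j" by blast
    with ij have neg: "C i j < 0" using Z[of i j] by linarith
    \<comment> \<open>The first bound keeps entry \<open>j\<close> positive after the decrease, the
      second keeps row \<open>j\<close> positive; the added 1 covers
      \<open>C j j = 0\<close>.\<close>
    define \<eta> where "\<eta> = min (v j / 2) (app v j / (2 * (\<bar>C j j\<bar> + 1)))"
    have vj: "0 < v j" "0 < app v j" using ij v by (auto simp: good_def S_def)
    then have \<eta>: "0 < \<eta>" by (simp add: \<eta>_def)
    have "\<eta> \<le> v j / 2" unfolding \<eta>_def by (rule min.cobounded1)
    with vj have \<eta>v: "\<eta> < v j" by linarith
    have "\<eta> * C j j < app v j"
    proof -
      have "\<eta> * C j j \<le> \<eta> * (\<bar>C j j\<bar> + 1)" using \<eta> by (intro mult_left_mono) auto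
      also have "\<dots> \<le> app v j / (2 * (\<bar>C j j\<bar> + 1)) * (\<bar>C j j\<bar> + 1)"
        by (intro mult_right_mono) (auto simp: \<eta>_def)
      also have "\<dots> = app v j / 2"
      proof -
        have "\<bar>C j j\<bar> + 1 \<noteq> 0" by linarith
        then show ?thesis by (simp add: field_simps)
      qed
      finally show ?thesis using vj by linarith
    qed
    define w where "w = v(j := v j - \<eta>)"
    have app_w: "app w l = app v l - \<eta> * C l j" for l
    proof -
      have "app w l = (\<Sum>p<n. C l p * v p - (if p = j then \<eta> * C l p else 0))"
        unfolding app_def w_def by (intro sum.cong) (auto simp: algebra_simps)
      then show ?thesis using ij by (simp add: app_def sum_subtractf)
    qed
    have ge: "app v l \<le> app w l" if "l < n" "l \<noteq> j" for l
      using Z[OF that(1) ij(3) that(2)] \<eta> by (simp add: app_w mult_le_0_iff)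
    have wj: "0 < app w j" using \<open>\<eta> * C j j < app v j\<close> by (simp add: app_w)
    have "good w"
      unfolding good_def
    proof (intro allI impI)
      fix l assume "l < n"
      then have "0 < v l \<and> 0 \<le> app v l \<and> (0 < app u l \<longrightarrow> 0 < app v l)"
        using v by (simp add: good_def)
      moreover have "0 < w l" using calculation \<eta>v by (simp add: w_def)
      moreover have "l = j \<or> app v l \<le> app w l" using ge[OF \<open>l < n\<close>] by blast
      ultimately show "0 < w l \<and> 0 \<le> app w l \<and> (0 < app u l \<longrightarrow> 0 < app w l)"
        using wj by (meson less_imp_le order.trans less_le_trans)
    qed
    have "0 < app w i"
    proof -
      have "0 \<le> app v i" using v ij by (simp add: good_def)
      moreover have "\<eta> * C i j < 0" using neg \<eta> by (simp add: mult_pos_neg)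
      ultimately show ?thesis by (simp add: app_w)
    qed
    moreover have "S v \<subseteq> S w"
    proof
      fix l assume "l \<in> S v"
      then have l: "l < n" "0 < app v l" by (auto simp: S_def)
      then have "0 < app w l" using wj ge[of l] by (cases "l = j") auto
      then show "l \<in> S w" using l by (simp add: S_def)
    qed
    ultimately have "insert i (S v) \<subseteq> S w" using ij by (simp add: S_def)
    then have "card (S v) < card (S w)"
      using card_mono[OF fin, of "insert i (S v)" w] ij fin[of v] by simp
    then show False using max[OF \<open>good w\<close>] by simp
  qed
  then have "\<forall>i<n. 0 < v i \<and> 0 < app v i" using v by (auto simp: good_def S_def)
  then show ?thesis unfolding semipositive_Z_def using Z by (auto simp: app_def)
qed

lemma finite_bound:
  fixes f :: "nat \<Rightarrow> real"
  obtains c where "0 < c" "\<And>i. i < n \<Longrightarrow> f i \<le> c"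
proof (rule that[of "1 + (\<Sum>i<n. \<bar>f i\<bar>)"])
  show "0 < 1 + (\<Sum>i<n. \<bar>f i\<bar>)" by (simp add: add_pos_nonneg sum_nonneg)
  fix i assume "i < n"
  then have "\<bar>f i\<bar> \<le> (\<Sum>i<n. \<bar>f i\<bar>)" by (intro member_le_sum) auto
  then show "f i \<le> 1 + (\<Sum>i<n. \<bar>f i\<bar>)" by linarith
qed

lemma finite_bound_less_1:
  fixes f :: "nat \<Rightarrow> real"
  assumes "\<And>i. i < n \<Longrightarrow> f i < 1"
  obtains c where "0 < c" "c < 1" "\<And>i. i < n \<Longrightarrow> f i \<le> c"
proof (cases "n = 0")
  case True
  then show ?thesis using that[of "1/2"] by simp
next
  case False
  then obtain l where "l < n" "\<And>i. i < n \<Longrightarrow> f i \<le> f l" using finite_argmax[of n f] by blast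
  \<comment> \<open>The maximum with \<open>1/2\<close> makes the constant positive even when all
    values are \<open>\<le> 0\<close>.\<close>
  then show ?thesis using assms[of l] by (intro that[of "max (1/2) (f l)"]) (auto simp: le_max_iff_disj)
qed

text \<open>Once \<open>v > 0\<close> with \<open>P v > H v\<close> is available, the errors
  contract in the \<open>v\<close>-weighted maximum norm: an error \<open>\<le> c v\<close> becomes
  at most \<open>c \<theta> v\<close>, where \<open>\<theta>\<close> is the largest quotient
  \<open>Hv i / Pv i\<close>. An upper bound suffices because the iterates stay above
  \<open>z\<close>.\<close>

lemma iteration_linear_convergence:
  fixes x :: "nat \<Rightarrow> nat \<Rightarrow> real"
  assumes k: "0 < k" and P: "semipositive_Z n P"
    and L: "\<And>i js. i < n \<Longrightarrow> js \<in> index_lists n k \<Longrightarrow> 0 \<le> L (i # js)"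
    and b: "\<And>i. i < n \<Longrightarrow> 0 \<le> b i"
    and z: "\<And>i. i < n \<Longrightarrow> 0 < z i"
    and fixpt: "\<And>i. i < n \<Longrightarrow> (\<Sum>j<n. P i j * z j ^ k) = tensor_form n k L i z + b i"
    and iter: "\<And>t i. i < n \<Longrightarrow> (\<Sum>j<n. P i j * x (Suc t) j ^ k) = tensor_form n k L i (x t) + b i"
    and ge: "\<And>t i. i < n \<Longrightarrow> z i \<le> x t i"
    and chain: "\<And>R. R \<subseteq> {..<n} \<Longrightarrow> R \<noteq> {} \<Longrightarrow> (\<And>i. i \<in> R \<Longrightarrow> b i = 0) \<Longrightarrow>
        (\<And>i j. i \<in> R \<Longrightarrow> j < n \<Longrightarrow> j \<notin> R \<Longrightarrow> P i j = 0) \<Longrightarrow>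
        (\<And>i j js. i \<in> R \<Longrightarrow> j < n \<Longrightarrow> j \<notin> R \<Longrightarrow> js \<in> index_lists n k \<Longrightarrow> j \<in> set js \<Longrightarrow> L (i # js) = 0) \<Longrightarrow>
        False"
  shows "\<exists>c r. 0 < c \<and> 0 < r \<and> r < 1 \<and> (\<forall>t. \<forall>i<n. x t i - z i \<le> c * r ^ t)"
proof -
  define H where "H = tensor_jac n k L z"
  define C where "C i j = P i j - H i j" for i j
  have H0: "0 \<le> H i j" if "i < n" "j < n" for i j
    unfolding H_def using that L z by (intro tensor_jac_nonneg) auto
  have P0: "P i j \<le> 0" if "i < n" "j < n" "i \<noteq> j" for i j
    using P that by (auto simp: semipositive_Z_def)
  have Cz: "(\<Sum>j<n. C i j * z j ^ k) = b i" if "i < n" for i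
    using fixpt[OF that] tensor_jac_self[OF k, of n z L i] z
    by (simp add: C_def H_def left_diff_distrib sum_subtractf)
  have "semipositive_Z n C"
  proof (rule semipositive_Z_chained[where u = "\<lambda>j. z j ^ k"])
    show "C i j \<le> 0" if "i < n" "j < n" "i \<noteq> j" for i j
      using P0[OF that] H0[OF that(1,2)] by (simp add: C_def)
    show "0 < z i ^ k" if "i < n" for i using z[OF that] by simp
    show "0 \<le> (\<Sum>j<n. C i j * z j ^ k)" if "i < n" for i using Cz[OF that] b[OF that] by simp
    fix R assume R: "R \<subseteq> {..<n}" "R \<noteq> {}" "\<And>i. i \<in> R \<Longrightarrow> (\<Sum>j<n. C i j * z j ^ k) = 0"
      "\<And>i j. i \<in> R \<Longrightarrow> j < n \<Longrightarrow> j \<notin> R \<Longrightarrow> C i j = 0"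
    \<comment> \<open>Off the diagonal \<open>P\<close> is nonpositive and \<open>H\<close>
      nonnegative, so nothing cancels in \<open>C = P - H\<close>: a zero entry is zero in
      both.\<close>
    have PH: "P i j = 0 \<and> H i j = 0" if "i \<in> R" "j < n" "j \<notin> R" for i j
    proof -
      have "i < n" "i \<noteq> j" using that R(1) by auto
      then show ?thesis using R(4)[OF that] P0[of i j] H0[of i j] that by (auto simp: C_def)
    qed
    show False
    proof (rule chain[OF R(1,2)])
      show "b i = 0" if "i \<in> R" for i using R(1,3) Cz[of i] that by auto
      show "P i j = 0" if "i \<in> R" "j < n" "j \<notin> R" for i j using PH[OF that] by simp
      show "L (i # js) = 0" if "i \<in> R" "j < n" "j \<notin> R" "js \<in> index_lists n k" "j \<in> set js" for i j js
        using that R(1) PH[of i j] L z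
        by (intro tensor_jac_eq_0D[where L = L and i = i and n = n and k = k and z = z and j = j]) (auto simp: H_def)
    qed
  qed
  then obtain v where v: "\<And>i. i < n \<Longrightarrow> 0 < v i" "\<And>i. i < n \<Longrightarrow> 0 < (\<Sum>j<n. C i j * v j)"
    unfolding semipositive_Z_def by blast
  define Hv where "Hv i = (\<Sum>j<n. H i j * v j)" for i
  define Pv where "Pv i = (\<Sum>j<n. P i j * v j)" for i
  have Hv0: "0 \<le> Hv i" if "i < n" for i
    unfolding Hv_def using H0 v(1) that by (intro sum_nonneg mult_nonneg_nonneg) (auto simp: less_imp_le)
  have HP: "Hv i < Pv i" if "i < n" for i
    using v(2)[OF that] by (simp add: C_def Hv_def Pv_def left_diff_distrib sum_subtractf)
  have "Hv i / Pv i < 1" if "i < n" for i using Hv0[OF that] HP[OF that] by (simp add: divide_less_eq)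
  then obtain \<theta> where \<theta>: "0 < \<theta>" "\<theta> < 1" "\<And>i. i < n \<Longrightarrow> Hv i / Pv i \<le> \<theta>"
    using finite_bound_less_1[of n "\<lambda>i. Hv i / Pv i"] by blast
  have H\<theta>: "Hv i \<le> \<theta> * Pv i" if "i < n" for i
    using \<theta>(3)[OF that] Hv0[OF that] HP[OF that] by (simp add: divide_le_eq)
  define e where "e t i = x t i ^ k - z i ^ k" for t i
  obtain c where c: "0 < c" "\<And>i. i < n \<Longrightarrow> e 0 i / v i \<le> c"
    using finite_bound[of n "\<lambda>i. e 0 i / v i"] by blast
  have e: "e t i \<le> c * \<theta> ^ t * v i" if "i < n" for t i
    using that
  proof (induction t arbitrary: i)
    case 0
    then show ?case using c(2)[OF 0] v(1)[OF 0] by (simp add: divide_le_eq)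
  next
    case (Suc t)
    show ?case
    proof (rule semipositive_Z_mono[OF P _ Suc.prems])
      fix i assume i: "i < n"
      have x0: "0 \<le> x t j \<and> 0 < z j" if "j < n" for j
        using z[OF that] ge[OF that, of t] by simp
      have "(\<Sum>j<n. P i j * e (Suc t) j) = tensor_form n k L i (x t) - tensor_form n k L i z"
        using fixpt[OF i] iter[OF i] by (simp add: e_def right_diff_distrib sum_subtractf)
      also have "\<dots> \<le> (\<Sum>j<n. H i j * e t j)"
        using tensor_form_tangent[OF k, of n L i "x t" z] tensor_jac_self[OF k, of n z L i] L[OF i] x0
        by (simp add: H_def e_def right_diff_distrib sum_subtractf)
      also have "\<dots> \<le> (\<Sum>j<n. H i j * (c * \<theta> ^ t * v j))"
        using H0[OF i] Suc.IH by (intro sum_mono mult_left_mono) auto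
      also have "\<dots> = c * \<theta> ^ t * Hv i"
        by (simp add: Hv_def sum_distrib_left mult_ac)
      also have "\<dots> \<le> c * \<theta> ^ t * (\<theta> * Pv i)"
        using H\<theta>[OF i] c(1) \<theta>(1) by (intro mult_left_mono) auto
      also have "\<dots> = (\<Sum>j<n. P i j * (c * \<theta> ^ Suc t * v j))"
        by (simp add: Pv_def sum_distrib_left mult_ac)
      finally show "(\<Sum>j<n. P i j * e (Suc t) j) \<le> (\<Sum>j<n. P i j * (c * \<theta> ^ Suc t * v j))" .
    qed
  qed
  \<comment> \<open>Return from \<open>k\<close>-th powers: for \<open>x \<ge> z > 0\<close> the
    difference \<open>x ^ k - z ^ k\<close> is at least
    \<open>(x - z) * z ^ (k - 1)\<close>.\<close>
  obtain D where D: "0 < D" "\<And>i. i < n \<Longrightarrow> v i / z i ^ (k - 1) \<le> D"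
    using finite_bound[of n "\<lambda>i. v i / z i ^ (k - 1)"] by blast
  have "x t i - z i \<le> c * D * \<theta> ^ t" if i: "i < n" for t i
  proof -
    have zp: "0 < z i ^ (k - 1)" using z[OF i] by simp
    have "(x t i - z i) * z i ^ (k - 1) \<le> e t i"
    proof -
      have "x t i * z i ^ (k - 1) \<le> x t i * x t i ^ (k - 1)"
        using z[OF i] ge[OF i, of t] by (intro mult_left_mono power_mono) auto
      then show ?thesis using k by (simp add: e_def left_diff_distrib power_eq_if)
    qed
    also have "\<dots> \<le> c * \<theta> ^ t * v i" by (rule e[OF i])
    finally have "x t i - z i \<le> c * \<theta> ^ t * (v i / z i ^ (k - 1))"
      using zp by (simp add: pos_le_divide_eq)
    also have "\<dots> \<le> c * \<theta> ^ t * D"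
      using c(1) \<theta>(1) D(2)[OF i] by (intro mult_left_mono) auto
    finally show ?thesis by (simp add: mult_ac)
  qed
  then show ?thesis using c(1) D(1) \<theta>(1,2) by (intro exI[of _ "c * D"] exI[of _ \<theta>]) auto
qed

section \<open>From the spectral radius of \<open>B\<close> to a positive test vector for
  \<open>s I - B\<close>\<close>

lemma spectral_radius_smult_less_1:
  fixes B :: "complex mat"
  assumes B: "B \<in> carrier_mat n n" and n: "0 < n" and s: "spectral_radius B < s" "0 < s"
  shows "spectral_radius (complex_of_real (1 / s) \<cdot>\<^sub>m B) < 1"
proof -
  let ?C = "complex_of_real (1 / s) \<cdot>\<^sub>m B"
  have C: "?C \<in> carrier_mat n n" using B by simp
  obtain ev where ev: "ev \<in> spectrum ?C" "spectral_radius ?C = norm ev"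
    using spectral_radius_mem_max(1)[OF C n] by auto
  then obtain v where v: "v \<in> carrier_vec n" "v \<noteq> 0\<^sub>v n" "?C *\<^sub>v v = ev \<cdot>\<^sub>v v"
    using B unfolding spectrum_def eigenvalue_def eigenvector_def by auto
  have "B *\<^sub>v v = complex_of_real s \<cdot>\<^sub>v (?C *\<^sub>v v)"
    using B v(1) s(2) by (intro eq_vecI) (auto simp: sum_distrib_left scalar_prod_def)
  also have "\<dots> = (complex_of_real s * ev) \<cdot>\<^sub>v v" unfolding v(3) by (simp add: smult_smult_assoc)
  finally have "complex_of_real s * ev \<in> spectrum B"
    using v B unfolding spectrum_def eigenvalue_def eigenvector_def by auto
  then have "norm (complex_of_real s * ev) \<le> spectral_radius B"
    by (intro spectral_radius_mem_max(2)[OF B n]) auto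
  then have "s * norm ev \<le> spectral_radius B" using s(2) by (simp add: norm_mult)
  then have "s * norm ev < s * 1" using s(1) by linarith
  then have "norm ev < 1" using s(2) by (simp only: mult_less_cancel_left_pos)
  then show ?thesis by (simp only: ev(2))
qed

lemma pow_mat_Suc_left:
  assumes A: "A \<in> carrier_mat n n"
  shows "A ^\<^sub>m Suc k = A * A ^\<^sub>m k"
proof (induction k)
  case (Suc k)
  have "A ^\<^sub>m Suc (Suc k) = A * A ^\<^sub>m k * A" using Suc by simp
  also have "\<dots> = A * (A ^\<^sub>m k * A)" using A by (intro assoc_mult_mat) auto
  finally show ?case by simp
qed (use A in simp)

text \<open>With \<open>P = s I - B\<close>, the vector \<open>u\<close> is a long enough partial sum of the Neumann series of
  \<open>(I - B/s)^(-1)\<close> applied to the vector of ones.\<close>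

lemma nonsingular_M_matrix_semipositive:
  assumes P: "nonsingular_M_matrix n P" and n: "0 < n"
  shows "semipositive_Z n (\<lambda>i j. P $$ (i, j))"
proof -
  obtain s B where B: "B \<in> carrier_mat n n" "0\<^sub>m n n \<le> B"
    and s: "spectral_radius (map_mat complex_of_real B) < s" and PsB: "P = s \<cdot>\<^sub>m 1\<^sub>m n - B"
    using P unfolding nonsingular_M_matrix_def by auto
  have B0: "0 \<le> B $$ (i, j)" if "i < n" "j < n" for i j
    using B that by (auto simp: less_eq_mat_def)
  let ?cB = "map_mat complex_of_real B"
  have cB: "?cB \<in> carrier_mat n n" using B by simp
  have r0: "0 \<le> spectral_radius ?cB"
    using spectral_radius_mem_max(1)[OF cB n] by auto
  \<comment> \<open>An intermediate value: the powers of \<open>B / s'\<close> are still bounded,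
    and the remaining factor \<open>s' / s < 1\<close> supplies geometric decay. It is positive even
    if the spectral radius is 0.\<close>
  define s' where "s' = (spectral_radius ?cB + s) / 2"
  have s': "spectral_radius ?cB < s'" "0 < s'" "s' < s" using r0 s by (auto simp: s'_def)
  define C where "C = (1 / s') \<cdot>\<^sub>m B"
  have C: "C \<in> carrier_mat n n" using B by (simp add: C_def)
  have Ck: "C ^\<^sub>m k \<in> carrier_mat n n" for k using C by simp
  have cC: "map_mat complex_of_real C = complex_of_real (1 / s') \<cdot>\<^sub>m ?cB"
    using B by (intro eq_matI) (auto simp: C_def)
  have cCc: "map_mat complex_of_real C \<in> carrier_mat n n" using C by simp
  obtain c where c: "\<And>k. norm_bound (map_mat complex_of_real C ^\<^sub>m k) c"
    using spectral_radius_jnf_norm_bound_less_1_upper_triangular[OF cCc]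
      spectral_radius_smult_less_1[OF cB n s'(1,2)] by (auto simp: cC)
  have bound: "\<bar>(C ^\<^sub>m k) $$ (i, j)\<bar> \<le> c" if "i < n" "j < n" for k i j
  proof -
    have "map_mat complex_of_real C ^\<^sub>m k = map_mat complex_of_real (C ^\<^sub>m k)"
      by (rule of_real_hom.mat_hom_pow[OF C, symmetric])
    then have "norm (complex_of_real ((C ^\<^sub>m k) $$ (i, j))) \<le> c"
      using c[of k] that C unfolding norm_bound_def by (auto simp: pow_mat_dim)
    then show ?thesis by simp
  qed
  \<comment> \<open>Row sums of the powers, that is, the entries of \<open>C^k\<close> applied to
    the vector of ones; with \<open>\<theta> = s' / s\<close> below,
    \<open>\<theta> ^ k * y k\<close> belongs to \<open>(B / s)^k\<close>.\<close>
  define y where "y k i = (\<Sum>j<n. (C ^\<^sub>m k) $$ (i, j))" for k i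
  have y_0: "y 0 i = 1" if "i < n" for i
    using that C by (simp add: y_def)
  have y_Suc: "s' * y (Suc k) i = (\<Sum>j<n. B $$ (i, j) * y k j)" if i: "i < n" for k i
  proof -
    have "C ^\<^sub>m Suc k = C * C ^\<^sub>m k" by (rule pow_mat_Suc_left[OF C]) 
    then have "(C ^\<^sub>m Suc k) $$ (i, l) = (\<Sum>j<n. C $$ (i, j) * (C ^\<^sub>m k) $$ (j, l))" if "l < n" for l
      using C Ck[of k] i that by (simp add: scalar_prod_def atLeast0LessThan)
    then have "y (Suc k) i = (\<Sum>l<n. \<Sum>j<n. C $$ (i, j) * (C ^\<^sub>m k) $$ (j, l))"
      by (simp add: y_def del: pow_mat.simps)
    also have "\<dots> = (\<Sum>j<n. C $$ (i, j) * y k j)"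
      unfolding y_def sum_distrib_left by (rule sum.swap)
    finally have "s' * y (Suc k) i = (\<Sum>j<n. s' * (C $$ (i, j) * y k j))"
      by (simp add: sum_distrib_left)
    also have "\<dots> = (\<Sum>j<n. B $$ (i, j) * y k j)"
      using s'(2) B i by (intro sum.cong) (auto simp: C_def)
    finally show ?thesis .
  qed
  have y0: "0 \<le> y k i" if "i < n" for k i
    using that
  proof (induction k arbitrary: i)
    case (Suc k)
    have "0 \<le> s' * y (Suc k) i"
      unfolding y_Suc[OF Suc.prems] using B0 Suc by (intro sum_nonneg mult_nonneg_nonneg) auto
    then show ?case using s'(2) by (simp add: zero_le_mult_iff)
  qed (simp add: y_0)
  have y_bound: "y k i \<le> n * \<bar>c\<bar>" if "i < n" for k i
  proof -
    have "(C ^\<^sub>m k) $$ (i, j) \<le> \<bar>c\<bar>" if "j < n" for j using bound[OF \<open>i < n\<close> that, of k] by linarith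
    then have "y k i \<le> (\<Sum>j<n. \<bar>c\<bar>)" unfolding y_def by (intro sum_mono) auto
    then show ?thesis by simp
  qed
  define \<theta> where "\<theta> = s' / s"
  have \<theta>: "0 < \<theta>" "\<theta> < 1" "s' = \<theta> * s" using s' by (auto simp: \<theta>_def)
  have "(\<lambda>K. \<theta> ^ K * (n * \<bar>c\<bar>)) \<longlonglongrightarrow> 0 * (n * \<bar>c\<bar>)"
    using \<theta> by (intro tendsto_intros LIMSEQ_power_zero) auto
  then have "(\<lambda>K. \<theta> ^ K * (n * \<bar>c\<bar>)) \<longlonglongrightarrow> 0" by simp
  then have "\<forall>\<^sub>F K in sequentially. \<theta> ^ K * (n * \<bar>c\<bar>) < 1"
    by (rule order_tendstoD) simp
  \<comment> \<open>Applied to the partial sum \<open>u\<close> of length \<open>K\<close>, the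
    matrix telescopes to \<open>s * (1 - \<theta> ^ K * y K i)\<close>, which this choice of
    \<open>K\<close> makes positive. The bound \<open>1 \<le> K\<close> keeps the term
    \<open>y 0 i = 1\<close> in \<open>u\<close>.\<close>
  then obtain K where K: "\<theta> ^ K * (n * \<bar>c\<bar>) < 1" "1 \<le> K"
    unfolding eventually_sequentially by (meson le_cases order_trans)
  define u where "u i = (\<Sum>k<K. \<theta> ^ k * y k i)" for i
  have Pij: "P $$ (i, j) = (if i = j then s else 0) - B $$ (i, j)" if "i < n" "j < n" for i j
    using that B by (simp add: PsB)
  have Py: "(\<Sum>j<n. P $$ (i, j) * v j) = s * v i - (\<Sum>j<n. B $$ (i, j) * v j)" if i: "i < n" for i v
  proof -
    have "(\<Sum>j<n. P $$ (i, j) * v j) = (\<Sum>j<n. (if i = j then s * v j else 0) - B $$ (i, j) * v j)"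
      using i by (intro sum.cong) (auto simp: Pij left_diff_distrib)
    then show ?thesis using i by (simp add: sum_subtractf)
  qed
  have "0 < u i \<and> 0 < (\<Sum>j<n. P $$ (i, j) * u j)" if i: "i < n" for i
  proof
    have "\<theta> ^ 0 * y 0 i \<le> u i"
      unfolding u_def using K(2) \<theta> y0[OF i] by (intro member_le_sum) auto
    then show "0 < u i" using y_0[OF i] by simp
    have "(\<Sum>j<n. B $$ (i, j) * u j) = (\<Sum>k<K. \<theta> ^ k * (\<Sum>j<n. B $$ (i, j) * y k j))"
      unfolding u_def sum_distrib_left by (subst sum.swap) (simp add: mult_ac)
    also have "\<dots> = (\<Sum>k<K. s * (\<theta> ^ Suc k * y (Suc k) i))"
      by (intro sum.cong refl) (simp add: y_Suc[OF i, symmetric] \<theta>(3))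
    finally have "(\<Sum>j<n. P $$ (i, j) * u j) = s * u i - (\<Sum>k<K. s * (\<theta> ^ Suc k * y (Suc k) i))"
      unfolding Py[OF i] by (rule arg_cong)
    also have "\<dots> = s * (\<Sum>k<K. \<theta> ^ k * y k i - \<theta> ^ Suc k * y (Suc k) i)"
      unfolding u_def by (simp only: sum_subtractf right_diff_distrib flip: sum_distrib_left)
    also have "\<dots> = s * (1 - \<theta> ^ K * y K i)"
      by (simp only: sum_lessThan_telescope'[of "\<lambda>k. \<theta> ^ k * y k i" K] y_0[OF i]) simp
    also have "\<dots> > 0"
    proof -
      have "\<theta> ^ K * y K i \<le> \<theta> ^ K * (n * \<bar>c\<bar>)"
        using y_bound[OF i] \<theta> by (intro mult_left_mono) auto
      then show ?thesis using K(1) s' by simp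
    qed
    finally show "0 < (\<Sum>j<n. P $$ (i, j) * u j)" .
  qed
  moreover have "P $$ (i, j) \<le> 0" if "i < n" "j < n" "i \<noteq> j" for i j
    using that B0[of i j] by (simp add: Pij)
  ultimately show ?thesis unfolding semipositive_Z_def by blast
qed

text \<open>Uniqueness of solutions excludes a kernel vector, so the determinant is nonzero and
  \<open>mat_inverse P\<close> is not \<open>None\<close>; only then does \<open>the\<close> denote
  the inverse.\<close>

lemma semipositive_Z_mat_inverse:
  fixes P :: "real mat"
  assumes P: "P \<in> carrier_mat n n" and Z: "semipositive_Z n (\<lambda>i j. P $$ (i, j))"
  shows "the (mat_inverse P) \<in> carrier_mat n n" "P * the (mat_inverse P) = 1\<^sub>m n"
proof -
  have "det P \<noteq> 0"
  proof
    assume "det P = 0"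
    then obtain v where v: "v \<in> carrier_vec n" "v \<noteq> 0\<^sub>v n" "P *\<^sub>v v = 0\<^sub>v n"
      using det_0_iff_vec_prod_zero[OF P] by blast
    have "(\<Sum>j<n. P $$ (i, j) * v $ j) = (\<Sum>j<n. P $$ (i, j) * 0)" if "i < n" for i
    proof -
      have "(P *\<^sub>v v) $ i = 0" using v(3) that by simp
      then show ?thesis using that P v(1) by (simp add: scalar_prod_def atLeast0LessThan)
    qed
    from semipositive_Z_unique[OF Z this] have "v $ i = 0" if "i < n" for i using that by blast
    then have "v = 0\<^sub>v n" using v(1) by (intro eq_vecI) auto
    with v(2) show False ..
  qed
  then have "P \<in> Units (ring_mat TYPE(real) n ())" by (rule det_non_zero_imp_unit[OF P])
  then have "mat_inverse P \<noteq> None" using mat_inverse(1)[OF P, of "()"] by blast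
  then obtain B where "mat_inverse P = Some B" by auto
  with mat_inverse(2)[OF P this] show "the (mat_inverse P) \<in> carrier_mat n n" "P * the (mat_inverse P) = 1\<^sub>m n"
    by auto
qed

section \<open>Principal subtensors and splittings\<close>

lemma bij_betw_pick:
  assumes "finite J"
  shows "bij_betw (pick J) {..<card J} J"
proof -
  have inj: "inj_on (pick J) {..<card J}"
    by (intro linorder_inj_onI') (metis lessThan_iff less_irrefl pick_mono)
  moreover have "pick J ` {..<card J} \<subseteq> J" by (auto intro: pick_in_set)
  ultimately have "pick J ` {..<card J} = J"
    using assms by (intro card_subset_eq) (auto simp: card_image)
  with inj show ?thesis by (simp add: bij_betw_def)
qed

lemma sum_pick:
  fixes g :: "nat \<Rightarrow> real"
  assumes "J \<subseteq> {..<n}"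
  shows "(\<Sum>j<n. g j) = (\<Sum>j<card J. g (pick J j)) + (\<Sum>j\<in>{..<n} - J. g j)"
proof -
  have "finite J" using assms finite_subset by blast
  then have "(\<Sum>j<card J. g (pick J j)) = (\<Sum>j\<in>J. g j)"
    by (rule sum.reindex_bij_betw[OF bij_betw_pick])
  then show ?thesis using sum.subset_diff[OF assms, of g] by simp
qed

lemma pick_less:
  assumes "J \<subseteq> {..<n}" "i < card J"
  shows "pick J i < n" "pick J i \<in> J"
  using assms pick_in_set[of i J] by auto

lemma map_pick_index_lists:
  assumes "J \<subseteq> {..<n}" "js \<in> index_lists (card J) k"
  shows "map (pick J) js \<in> index_lists n k"
  using assms(2) pick_less(1)[OF assms(1)] by (auto simp: index_lists_def)

lemma inj_on_map_pick:
  assumes "finite J"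
  shows "inj_on (map (pick J)) (index_lists (card J) k)"
proof (rule inj_onI)
  fix xs ys assume "xs \<in> index_lists (card J) k" "ys \<in> index_lists (card J) k"
    and eq: "map (pick J) xs = map (pick J) ys"
  then have "set xs \<union> set ys \<subseteq> {..<card J}" by (auto simp: index_lists_def)
  then have "inj_on (pick J) (set xs \<union> set ys)"
    using bij_betw_pick[OF assms] by (auto simp: bij_betw_def intro: inj_on_subset)
  then show "xs = ys" using eq by (rule map_inj_on[rotated])
qed

lemma map_pick_index_lists_image:
  assumes J: "J \<subseteq> {..<n}"
  shows "map (pick J) ` index_lists (card J) k = {js \<in> index_lists n k. set js \<subseteq> J}"
proof (rule subset_antisym)
  have fin: "finite J" using J finite_subset by blast
  show "map (pick J) ` index_lists (card J) k \<subseteq> {js \<in> index_lists n k. set js \<subseteq> J}"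
  proof (rule image_subsetI)
    fix js assume js: "js \<in> index_lists (card J) k"
    have "set (map (pick J) js) \<subseteq> J" using pick_less(2)[OF J index_lists_mem[OF js]] by auto
    then show "map (pick J) js \<in> {js \<in> index_lists n k. set js \<subseteq> J}"
      using map_pick_index_lists[OF J js] by simp
  qed
  show "{js \<in> index_lists n k. set js \<subseteq> J} \<subseteq> map (pick J) ` index_lists (card J) k"
  proof
    fix js assume js: "js \<in> {js \<in> index_lists n k. set js \<subseteq> J}"
    define g where "g = inv_into {..<card J} (pick J)"
    have g: "g j < card J \<and> pick J (g j) = j" if "j \<in> J" for j
      using that bij_betw_pick[OF fin] f_inv_into_f[of j "pick J" "{..<card J}"]
        inv_into_into[of j "pick J" "{..<card J}"] by (auto simp: bij_betw_def g_def)
    have "map (pick J) (map g js) = js"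
      using js g by (auto intro!: map_idI)
    moreover have "map g js \<in> index_lists (card J) k"
      using js g by (auto simp: index_lists_def)
    ultimately show "js \<in> map (pick J) ` index_lists (card J) k" by (metis imageI)
  qed
qed

text \<open>The second sum is what the subtensor loses. It vanishes for \<open>f\<close> supported
  in \<open>J\<close>, and it is nonnegative for a nonnegative tensor and \<open>f \<ge> 0\<close>;
  both cases occur below.\<close>

lemma tensor_form_pick:
  assumes J: "J \<subseteq> {..<n}"
  shows "tensor_form n k A (pick J i) f =
    tensor_form (card J) k (subtensor A J) i (\<lambda>j. f (pick J j)) +
    (\<Sum>js\<in>{js \<in> index_lists n k. \<not> set js \<subseteq> J}. A (pick J i # js) * (\<Prod>j\<leftarrow>js. f j))"
proof -
  let ?g = "\<lambda>js. A (pick J i # js) * (\<Prod>j\<leftarrow>js. f j)"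
  have fin: "finite J" using J finite_subset by blast
  have "tensor_form (card J) k (subtensor A J) i (\<lambda>j. f (pick J j)) =
      (\<Sum>js\<in>index_lists (card J) k. ?g (map (pick J) js))"
    by (simp add: tensor_form_def subtensor_def comp_def)
  also have "\<dots> = (\<Sum>js\<in>{js \<in> index_lists n k. set js \<subseteq> J}. ?g js)"
    using sum.reindex[OF inj_on_map_pick[OF fin], of ?g k] map_pick_index_lists_image[OF J, of k]
    by (simp add: comp_def)
  finally show ?thesis
    unfolding tensor_form_def
    by (simp add: sum.union_disjoint[symmetric] Int_def flip: Collect_disj_eq)
      (rule sum.cong; auto)
qed

lemma prod_list_eq_0_map:
  fixes f :: "'a \<Rightarrow> real"
  shows "j \<in> set js \<Longrightarrow> f j = 0 \<Longrightarrow> (\<Prod>j\<leftarrow>js. f j) = 0"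
  by (induction js) auto

lemma tensor_form_pick_supported:
  assumes J: "J \<subseteq> {..<n}" and f: "\<And>j. j < n \<Longrightarrow> j \<notin> J \<Longrightarrow> f j = 0"
  shows "tensor_form (card J) k (subtensor A J) i (\<lambda>j. f (pick J j)) = tensor_form n k A (pick J i) f"
proof -
  have "(\<Prod>j\<leftarrow>js. f j) = 0" if js: "js \<in> index_lists n k" "\<not> set js \<subseteq> J" for js
  proof -
    obtain j where "j \<in> set js" "j \<notin> J" using js by auto
    then show ?thesis using f index_lists_mem[OF js(1)] by (intro prod_list_eq_0_map) auto
  qed
  then show ?thesis by (simp add: tensor_form_pick[OF J] sum.neutral)
qed

lemma tensor_form_pick_le:
  assumes J: "J \<subseteq> {..<n}" and i: "i < card J"
    and L: "\<And>js. js \<in> index_lists n k \<Longrightarrow> 0 \<le> L (pick J i # js)"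
    and f: "\<And>j. j < n \<Longrightarrow> 0 \<le> f j"
  shows "tensor_form (card J) k (subtensor L J) i (\<lambda>j. f (pick J j)) \<le> tensor_form n k L (pick J i) f"
proof -
  have "0 \<le> (\<Sum>js\<in>{js \<in> index_lists n k. \<not> set js \<subseteq> J}. L (pick J i # js) * (\<Prod>j\<leftarrow>js. f j))"
    using L f by (intro sum_nonneg mult_nonneg_nonneg prod_list_nonneg_map) (auto dest: index_lists_mem)
  then show ?thesis by (simp add: tensor_form_pick[OF J])
qed

lemma semipositive_Z_pick_le:
  assumes P: "semipositive_Z n P" and J: "J \<subseteq> {..<n}" and i: "i < card J"
    and v: "\<And>j. j < n \<Longrightarrow> 0 \<le> v j"
  shows "(\<Sum>j<n. P (pick J i) j * v j) \<le> (\<Sum>j<card J. P (pick J i) (pick J j) * v (pick J j))"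
proof -
  have "(\<Sum>j\<in>{..<n} - J. P (pick J i) j * v j) \<le> 0"
    using P pick_less[OF J i] v unfolding semipositive_Z_def
    by (intro sum_nonpos mult_nonpos_nonneg) fastforce+
  then show ?thesis using sum_pick[OF J, of "\<lambda>j. P (pick J i) j * v j"] by simp
qed

text \<open>The restricted test vector still works: the deleted terms of each retained row are
  off-diagonal entries times positive numbers, and dropping them can only raise the row sum.\<close>

lemma semipositive_Z_pick:
  assumes P: "semipositive_Z n P" and J: "J \<subseteq> {..<n}"
  shows "semipositive_Z (card J) (\<lambda>i j. P (pick J i) (pick J j))"
proof -
  obtain u where u: "\<And>i. i < n \<Longrightarrow> 0 < u i" "\<And>i. i < n \<Longrightarrow> 0 < (\<Sum>j<n. P i j * u j)"
    using P unfolding semipositive_Z_def by blast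
  have "0 < (\<Sum>j<card J. P (pick J i) (pick J j) * u (pick J j))" if "i < card J" for i
    using semipositive_Z_pick_le[OF P J that, of u] u(2)[OF pick_less(1)[OF J that]] u(1)
    by (force intro: less_imp_le)
  moreover have "P (pick J i) (pick J j) \<le> 0" if "i < card J" "j < card J" "i \<noteq> j" for i j
  proof -
    have "finite J" using J finite_subset by blast
    then have "pick J i \<noteq> pick J j"
      using that bij_betw_pick[of J] by (auto simp: bij_betw_def inj_on_def)
    then show ?thesis using P pick_less(1)[OF J] that unfolding semipositive_Z_def by blast
  qed
  ultimately show ?thesis
    unfolding semipositive_Z_def using u(1) pick_less(1)[OF J] by (intro conjI exI[of _ "\<lambda>j. u (pick J j)"]) auto
qed

text \<open>Comparing with \<open>replicate k (hd js)\<close> recognises constant lists without an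
  existential quantifier; \<open>0 < k\<close> makes the head meaningful and the correspondence with
  single indices one-to-one.\<close>

lemma sum_constant_lists:
  fixes g :: "nat list \<Rightarrow> real"
  assumes k: "0 < k"
  shows "(\<Sum>js\<in>index_lists n k. if js = replicate k (hd js) then g js else 0) = (\<Sum>j<n. g (replicate k j))"
proof -
  have "(\<Sum>js\<in>index_lists n k. if js = replicate k (hd js) then g js else 0) =
      (\<Sum>js\<in>{js \<in> index_lists n k. js = replicate k (hd js)}. g js)"
    by (simp add: sum.inter_filter)
  also have "\<dots> = (\<Sum>j<n. g (replicate k j))"
    using k by (intro sum.reindex_bij_witness[of _ "replicate k" hd])
      (auto simp: index_lists_def intro!: index_lists_mem[of _ n k] dest: hd_in_set)
  finally show ?thesis .
qed

text \<open>All assumptions pass to principal subtensors, so the facts below serve the original and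
  the reduced equation alike. \<open>P\<close> enters \<open>A\<close> only at constant tails, as a
  level-1 splitting prescribes; \<open>Z_tensor\<close> provides the form \<open>s I - B\<close> for
  comparison arguments, where the positivity comes from a vector with positive image.\<close>

locale M_splitting =
  fixes n k :: nat and A L :: tensor and P :: "nat \<Rightarrow> nat \<Rightarrow> real" and b :: "nat \<Rightarrow> real"
  assumes k: "0 < k"
    and P: "semipositive_Z n P"
    and L: "\<And>i js. i < n \<Longrightarrow> js \<in> index_lists n k \<Longrightarrow> 0 \<le> L (i # js)"
    and b: "\<And>i. i < n \<Longrightarrow> 0 \<le> b i"
    and split: "\<And>i js. i < n \<Longrightarrow> js \<in> index_lists n k \<Longrightarrow>
      A (i # js) = (if js = replicate k (hd js) then P i (hd js) else 0) - L (i # js)"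
    and Z_tensor: "\<exists>s B. \<forall>i<n. \<forall>js\<in>index_lists n k.
      A (i # js) = s * identity_tensor (i # js) - B (i # js) \<and> 0 \<le> B (i # js)"
begin

lemma form_eq:
  assumes i: "i < n"
  shows "tensor_form n k A i f = (\<Sum>j<n. P i j * f j ^ k) - tensor_form n k L i f"
proof -
  have "tensor_form n k A i f =
      (\<Sum>js\<in>index_lists n k. (if js = replicate k (hd js) then P i (hd js) * (\<Prod>j\<leftarrow>js. f j) else 0)
        - L (i # js) * (\<Prod>j\<leftarrow>js. f j))"
    unfolding tensor_form_def by (intro sum.cong refl) (auto simp: split[OF i] left_diff_distrib)
  then show ?thesis
    using k by (simp add: sum_subtractf sum_constant_lists[OF k] tensor_form_def prod_list_replicate)
qed

lemma comparison:
  assumes g: "\<And>i. i < n \<Longrightarrow> 0 < g i \<and> 0 < tensor_form n k A i g"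
    and f: "\<And>i. i < n \<Longrightarrow> 0 \<le> f i"
    and le: "\<And>i. i < n \<Longrightarrow> tensor_form n k A i f \<le> tensor_form n k A i g"
    and i: "i < n"
  shows "f i \<le> g i"
proof -
  obtain s B where B: "\<And>i js. i < n \<Longrightarrow> js \<in> index_lists n k \<Longrightarrow>
      A (i # js) = s * identity_tensor (i # js) - B (i # js)"
    and B0: "\<And>i js. i < n \<Longrightarrow> js \<in> index_lists n k \<Longrightarrow> 0 \<le> B (i # js)"
    using Z_tensor by blast
  have A: "tensor_form n k A i h = s * h i ^ k - tensor_form n k B i h" if i: "i < n" for i h
  proof -
    have "tensor_form n k A i h =
      (\<Sum>js\<in>index_lists n k. (if js = replicate k (hd js) then if hd js = i then s * h i ^ k else 0 else 0)
        - B (i # js) * (\<Prod>j\<leftarrow>js. h j))"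
      unfolding tensor_form_def
    proof (rule sum.cong[OF refl])
      fix js assume js: "js \<in> index_lists n k"
      then have len: "length js = k" "js \<noteq> []" using k by (auto simp: index_lists_def)
      have "identity_tensor (i # js) = (if js = replicate k i then 1 else 0)"
        using len unfolding identity_tensor_def diagonal_index_def
        by (auto simp: Cons_replicate_eq)
      moreover have "js = replicate k i \<longleftrightarrow> js = replicate k (hd js) \<and> hd js = i"
        using k by (metis hd_replicate less_numeral_extra(3))
      moreover have "js = replicate k i \<Longrightarrow> (\<Prod>j\<leftarrow>js. h j) = h i ^ k"
        by (simp add: prod_list_replicate)
      ultimately have "s * identity_tensor (i # js) * (\<Prod>j\<leftarrow>js. h j) =
          (if js = replicate k (hd js) then if hd js = i then s * h i ^ k else 0 else 0)"
        by (cases "js = replicate k i") auto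
      then show "A (i # js) * (\<Prod>j\<leftarrow>js. h j) =
          (if js = replicate k (hd js) then if hd js = i then s * h i ^ k else 0 else 0)
          - B (i # js) * (\<Prod>j\<leftarrow>js. h j)"
        by (simp only: B[OF i js] left_diff_distrib)
    qed
    then show ?thesis
      using k i by (simp add: sum_subtractf sum_constant_lists[OF k] tensor_form_def sum.delta)
  qed
  show ?thesis by (rule tensor_form_comparison[where B = B and A = A and s = s, OF k B0 A g f le i])
qed

text \<open>Since \<open>pick J\<close> is injective, renumbering neither creates nor destroys
  constant or diagonal index lists, so the case distinctions in \<open>split\<close> and in the
  identity tensor survive.\<close>

lemma sub:
  assumes J: "J \<subseteq> {..<n}"
  shows "M_splitting (card J) k (subtensor A J) (subtensor L J)
    (\<lambda>i j. P (pick J i) (pick J j)) (\<lambda>i. b (pick J i))"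
proof
  have fin: "finite J" using J finite_subset by blast
  show "0 < k" by (rule k)
  show "semipositive_Z (card J) (\<lambda>i j. P (pick J i) (pick J j))"
    by (rule semipositive_Z_pick[OF P J])
  show "0 \<le> b (pick J i)" if "i < card J" for i using b pick_less(1)[OF J that] by simp
  fix i js assume i: "i < card J" and js: "js \<in> index_lists (card J) k"
  note p = pick_less(1)[OF J i] map_pick_index_lists[OF J js]
  show "0 \<le> subtensor L J (i # js)" using L[OF p] by (simp add: subtensor_def)
  have ne: "js \<noteq> []" using js k by (auto simp: index_lists_def)
  then have "hd js < card J" using hd_in_set index_lists_mem[OF js] by blast
  then have "replicate k (hd js) \<in> index_lists (card J) k"
    by (auto simp: index_lists_def)
  then have "map (pick J) js = map (pick J) (replicate k (hd js)) \<longleftrightarrow> js = replicate k (hd js)"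
    using inj_on_map_pick[OF fin] js by (metis inj_onD)
  then show "subtensor A J (i # js) =
      (if js = replicate k (hd js) then P (pick J i) (pick J (hd js)) else 0) - subtensor L J (i # js)"
    using split[OF p] ne by (simp add: subtensor_def hd_map)
next
  have fin: "finite J" using J finite_subset by blast
  obtain s B where B: "\<And>i js. i < n \<Longrightarrow> js \<in> index_lists n k \<Longrightarrow>
      A (i # js) = s * identity_tensor (i # js) - B (i # js) \<and> 0 \<le> B (i # js)"
    using Z_tensor by blast
  have id_pick: "identity_tensor (map (pick J) js) = identity_tensor js"
    if "js \<in> index_lists (card J) (Suc k)" for js
  proof -
    have "diagonal_index (map (pick J) js) \<longleftrightarrow> diagonal_index js"
    proof
      assume "diagonal_index (map (pick J) js)"
      then obtain j where j: "map (pick J) js = replicate (length js) j"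
        by (auto simp: diagonal_index_def)
      have ne: "js \<noteq> []" using that by (auto simp: index_lists_def)
      have "pick J (hd js) = j" using j ne by (metis hd_map hd_replicate length_0_conv)
      then have "map (pick J) js = map (pick J) (replicate (length js) (hd js))" using j by simp
      moreover have "replicate (length js) (hd js) \<in> index_lists (card J) (Suc k)"
        using that hd_in_set[OF ne] by (auto simp: index_lists_def)
      ultimately have "js = replicate (length js) (hd js)"
        using inj_on_map_pick[OF fin] that by (metis inj_onD)
      then show "diagonal_index js" unfolding diagonal_index_def by blast
    next
      assume "diagonal_index js"
      then obtain j where "js = replicate (length js) j" by (auto simp: diagonal_index_def)
      then have "map (pick J) js = replicate (length js) (pick J j)" by (metis map_replicate)
      then show "diagonal_index (map (pick J) js)" by (auto simp: diagonal_index_def)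
    qed
    then show ?thesis by (simp add: identity_tensor_def)
  qed
  have "subtensor A J (i # js) = s * identity_tensor (i # js) - subtensor B J (i # js) \<and>
      0 \<le> subtensor B J (i # js)"
    if "i < card J" "js \<in> index_lists (card J) k" for i js
  proof -
    have "i # js \<in> index_lists (card J) (Suc k)" using that by (auto simp: index_lists_def)
    then have "identity_tensor (pick J i # map (pick J) js) = identity_tensor (i # js)"
      using id_pick[of "i # js"] by simp
    then show ?thesis
      using B[OF pick_less(1)[OF J that(1)] map_pick_index_lists[OF J that(2)]]
      by (simp add: subtensor_def)
  qed
  then show "\<exists>s B. \<forall>i<card J. \<forall>js\<in>index_lists (card J) k.
      subtensor A J (i # js) = s * identity_tensor (i # js) - B (i # js) \<and> 0 \<le> B (i # js)"
    by blast
qed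

end

section \<open>Zero entries of the semi-symmetrised matrix\<close>

lemma semi_symmetric_Cons:
  "semi_symmetric (Suc k) T (i # ls) = (\<Sum>\<pi> | \<pi> permutes {..<k}. T (i # permute_list \<pi> ls)) / fact k"
  by (simp add: semi_symmetric_def)

lemma permute_index_lists:
  assumes "js \<in> index_lists n k" "\<pi> permutes {..<k}"
  shows "permute_list \<pi> js \<in> index_lists n k" "set (permute_list \<pi> js) = set js"
  using assms by (auto simp: index_lists_def set_permute_list)

lemma tensor_mat_semi_symmetric_index:
  assumes "i < n" "j < n"
  shows "tensor_mat (Suc k) n (semi_symmetric (Suc k) T) (ones_vec n) $$ (i, j) =
    (\<Sum>js\<in>index_lists n (k - 1). semi_symmetric (Suc k) T (i # j # js))"
proof -
  have "map (\<lambda>l. ones_vec n $ l) js = map (\<lambda>_. 1) js" if "js \<in> index_lists n (k - 1)" for js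
    using index_lists_mem[OF that] by (simp add: ones_vec_def)
  then have "(\<Prod>l\<leftarrow>js. ones_vec n $ l) = 1" if "js \<in> index_lists n (k - 1)" for js
    using that by (simp add: prod_list_const_map del: map_eq_conv)
  then show ?thesis using assms by (simp add: tensor_mat_def)
qed

lemma Cons_index_lists:
  assumes "0 < k" "j < n" "js \<in> index_lists n (k - 1)"
  shows "j # js \<in> index_lists n k"
  using assms by (auto simp: index_lists_def)

lemma tensor_mat_semi_symmetric_eq_0:
  assumes k: "0 < k" and ij: "i < n" "j < n"
    and T: "\<And>js. js \<in> index_lists n k \<Longrightarrow> j \<in> set js \<Longrightarrow> T (i # js) = 0"
  shows "tensor_mat (Suc k) n (semi_symmetric (Suc k) T) (ones_vec n) $$ (i, j) = 0"
  unfolding tensor_mat_semi_symmetric_index[OF ij]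
proof (rule sum.neutral, rule ballI)
  fix js assume "js \<in> index_lists n (k - 1)"
  then have "j # js \<in> index_lists n k" by (rule Cons_index_lists[OF k ij(2)])
  then have "T (i # permute_list \<pi> (j # js)) = 0" if "\<pi> permutes {..<k}" for \<pi>
    using permute_index_lists[OF _ that, of "j # js" n] by (intro T) auto
  then show "semi_symmetric (Suc k) T (i # j # js) = 0" by (simp add: semi_symmetric_Cons)
qed

text \<open>Every list through \<open>j\<close> is a permutation of one that begins with
  \<open>j\<close>, hence occurs with positive weight in entry \<open>(i, j)\<close>. For
  nonnegative rows a zero entry thus excludes \<open>j\<close> from every position, not only the
  first.\<close>

lemma tensor_mat_semi_symmetric_eq_0D:
  assumes k: "0 < k" and ij: "i < n" "j < n"
    and T: "\<And>js. js \<in> index_lists n k \<Longrightarrow> 0 \<le> T (i # js)"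
    and zero: "tensor_mat (Suc k) n (semi_symmetric (Suc k) T) (ones_vec n) $$ (i, j) = 0"
    and js: "js \<in> index_lists n k" "j \<in> set js"
  shows "T (i # js) = 0"
proof -
  have T\<pi>: "0 \<le> T (i # permute_list \<pi> ls)" if "\<pi> permutes {..<k}" "ls \<in> index_lists n k" for \<pi> ls
    by (rule T[OF permute_index_lists(1)[OF that(2,1)]])
  have nonneg: "0 \<le> semi_symmetric (Suc k) T (i # ls)" if "ls \<in> index_lists n k" for ls
    unfolding semi_symmetric_Cons
    by (intro divide_nonneg_nonneg sum_nonneg) (auto intro: T\<pi>[OF _ that])
  have fin: "finite {\<pi>. \<pi> permutes {..<k}}" by (rule finite_permutations) simp
  let ?ls = "remove1 j js"
  have ls: "?ls \<in> index_lists n (k - 1)"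
    using js set_remove1_subset[of j js] by (auto simp: index_lists_def length_remove1)
  have jls: "j # ?ls \<in> index_lists n k" by (rule Cons_index_lists[OF k ij(2) ls])
  have "\<forall>ls\<in>index_lists n (k - 1). semi_symmetric (Suc k) T (i # j # ls) = 0"
    using zero nonneg[OF Cons_index_lists[OF k ij(2)]] unfolding tensor_mat_semi_symmetric_index[OF ij]
    by (subst (asm) sum_nonneg_eq_0_iff) auto
  then have "(\<Sum>\<pi> | \<pi> permutes {..<k}. T (i # permute_list \<pi> (j # ?ls))) = 0"
    using ls by (simp add: semi_symmetric_Cons)
  then have "\<forall>\<pi>\<in>{\<pi>. \<pi> permutes {..<k}}. T (i # permute_list \<pi> (j # ?ls)) = 0"
    using T\<pi>[OF _ jls] by (subst (asm) sum_nonneg_eq_0_iff[OF fin]) auto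
  moreover have "mset js = mset (j # ?ls)" using js by simp
  then obtain \<pi> where "\<pi> permutes {..<length (j # ?ls)}" "permute_list \<pi> (j # ?ls) = js"
    by (rule mset_eq_permutation)
  moreover have "length (j # ?ls) = k" using jls unfolding index_lists_def by blast
  ultimately show ?thesis by auto
qed

lemma semipositive_Z_cong:
  assumes "\<And>i j. i < n \<Longrightarrow> j < n \<Longrightarrow> P i j = Q i j"
  shows "semipositive_Z n P \<longleftrightarrow> semipositive_Z n Q"
proof -
  have "(\<Sum>j<n. P i j * u j) = (\<Sum>j<n. Q i j * u j)" if "i < n" for i u
    using assms that by (intro sum.cong) auto
  then show ?thesis unfolding semipositive_Z_def using assms by (auto cong: conj_cong)
qed

lemma mult_mat_vec_sum:
  assumes "M \<in> carrier_mat n n" "v \<in> carrier_vec n" "i < n"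
  shows "(M *\<^sub>v v) $ i = (\<Sum>j<n. M $$ (i, j) * v $ j)"
  using assms by (auto simp: scalar_prod_def atLeast0LessThan)

lemma mult_mat_sum:
  assumes "M \<in> carrier_mat n n" "N \<in> carrier_mat n n" "i < n" "j < n"
  shows "(M * N) $$ (i, j) = (\<Sum>l<n. M $$ (i, l) * N $$ (l, j))"
  using assms by (auto simp: scalar_prod_def atLeast0LessThan)

section \<open>Isolated index sets and the conditions that exclude them\<close>

context M_splitting
begin

text \<open>A homogeneous closed subsystem: no index outside \<open>R\<close> influences a row in
  \<open>R\<close>, while the converse influence is allowed. For a positive solution
  \<open>z\<close>, the vector \<open>z^[k]\<close> restricted to \<open>R\<close> is then fixed by
  the linearised iteration.\<close>

definition isolated :: "nat set \<Rightarrow> bool" where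
  "isolated R \<longleftrightarrow> R \<subseteq> {..<n} \<and> R \<noteq> {} \<and>
     (\<forall>i\<in>R. b i = 0 \<and> (\<forall>j<n. j \<notin> R \<longrightarrow>
        P i j = 0 \<and> (\<forall>js\<in>index_lists n k. j \<in> set js \<longrightarrow> L (i # js) = 0)))"

lemma isolatedD:
  assumes "isolated R"
  shows "R \<subseteq> {..<n}" "R \<noteq> {}" "i \<in> R \<Longrightarrow> b i = 0"
    "i \<in> R \<Longrightarrow> j < n \<Longrightarrow> j \<notin> R \<Longrightarrow> P i j = 0"
    "i \<in> R \<Longrightarrow> j < n \<Longrightarrow> j \<notin> R \<Longrightarrow> js \<in> index_lists n k \<Longrightarrow> j \<in> set js \<Longrightarrow> L (i # js) = 0"
  using assms unfolding isolated_def by auto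

text \<open>The vector \<open>w = P^(-1) b\<close> solves \<open>P w = b\<close>; on an isolated set
  the right-hand side and the outer block vanish, which forces \<open>w = 0\<close> there.
  \<open>Pm\<close> is the matrix form of the function \<open>P\<close>, as
  \<open>mat_inverse\<close> requires.\<close>

lemma not_isolated_if_inverse_pos:
  assumes Pm: "Pm \<in> carrier_mat n n" "\<And>i j. i < n \<Longrightarrow> j < n \<Longrightarrow> Pm $$ (i, j) = P i j"
    and bv: "bv \<in> carrier_vec n" "\<And>i. i < n \<Longrightarrow> bv $ i = b i"
    and pos: "vec_less (0\<^sub>v n) (the (mat_inverse Pm) *\<^sub>v bv)"
  shows "\<not> isolated R"
proof
  assume R: "isolated R"
  let ?w = "the (mat_inverse Pm) *\<^sub>v bv"
  have "semipositive_Z n (\<lambda>i j. Pm $$ (i, j))" using P Pm(2) semipositive_Z_cong[of n "\<lambda>i j. Pm $$ (i, j)" P] by simp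
  note inv = semipositive_Z_mat_inverse[OF Pm(1) this]
  have w: "?w \<in> carrier_vec n" using inv(1) bv(1) by simp
  have "Pm *\<^sub>v ?w = bv" using inv Pm(1) bv(1) by (simp flip: assoc_mult_mat_vec)
  then have eq: "(\<Sum>j<n. P i j * ?w $ j) = b i" if "i < n" for i
    using mult_mat_vec_sum[OF Pm(1) w that] bv(2)[OF that] Pm(2)[OF that] by simp
  have w0: "0 < ?w $ i" if "i < n" for i
    using pos that w by (auto simp: vec_less_def)
  obtain i where i: "i \<in> R" "i < n" using isolatedD(1,2)[OF R] by blast
  have "?w $ i = 0"
  proof (rule semipositive_Z_block_zero[OF P _ _ _ i])
    show "0 \<le> ?w $ i" if "i < n" for i using w0[OF that] by simp
    show "P i j = 0" if "i \<in> R" "i < n" "j < n" "j \<notin> R" for i j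
      using isolatedD(4)[OF R] that by blast
    show "(\<Sum>j<n. P i j * ?w $ j) \<le> 0" if "i \<in> R" "i < n" for i
      using eq[OF that(2)] isolatedD(3)[OF R that(1)] by simp
  qed
  with w0[OF i(2)] show False by simp
qed

text \<open>Both factors inherit the zero block of rows in \<open>R\<close> and columns outside: for
  the inverse, its column \<open>j\<close> solves a system whose right-hand side vanishes on
  \<open>R\<close>. So the product is reducible; the index \<open>l\<close> with
  \<open>0 < b l\<close> shows that \<open>R\<close> is a proper subset.\<close>

lemma not_isolated_if_irreducible:
  assumes Pm: "Pm \<in> carrier_mat n n" "\<And>i j. i < n \<Longrightarrow> j < n \<Longrightarrow> Pm $$ (i, j) = P i j"
    and b_pos: "l < n" "0 < b l"
    and irr: "irreducible_mat (the (mat_inverse Pm) *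
        tensor_mat (Suc k) n (semi_symmetric (Suc k) L) (ones_vec n))"
  shows "\<not> isolated R"
proof
  assume R: "isolated R"
  let ?T = "tensor_mat (Suc k) n (semi_symmetric (Suc k) L) (ones_vec n)"
  let ?I = "the (mat_inverse Pm)"
  have Z: "semipositive_Z n (\<lambda>i j. Pm $$ (i, j))" using P Pm(2) semipositive_Z_cong[of n "\<lambda>i j. Pm $$ (i, j)" P] by simp
  note inv = semipositive_Z_mat_inverse[OF Pm(1) Z]
  have T: "?T \<in> carrier_mat n n" by (simp add: tensor_mat_def)
  have T0: "?T $$ (i, j) = 0" if "i \<in> R" "j < n" "j \<notin> R" for i j
    using that isolatedD(1)[OF R] isolatedD(5)[OF R that]
    by (intro tensor_mat_semi_symmetric_eq_0 k) auto
  have PI: "(\<Sum>l<n. P i l * ?I $$ (l, j)) = (if i = j then 1 else 0)" if "i < n" "j < n" for i j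
    using mult_mat_sum[OF Pm(1) inv(1) that] inv(2) Pm(2) that by simp
  have I_nonneg: "0 \<le> ?I $$ (i, j)" if "i < n" "j < n" for i j
    by (rule semipositive_Z_nonneg[OF P _ that(1)]) (simp add: PI that(2))
  have I0: "?I $$ (i, j) = 0" if i: "i \<in> R" and j: "j < n" "j \<notin> R" for i j
  proof (rule semipositive_Z_block_zero[OF P _ _ _ i])
    show "i < n" using i isolatedD(1)[OF R] by auto
    show "0 \<le> ?I $$ (i, j)" if "i < n" for i by (rule I_nonneg[OF that j(1)])
    show "P i j = 0" if "i \<in> R" "i < n" "j < n" "j \<notin> R" for i j
      using isolatedD(4)[OF R] that by blast
    show "(\<Sum>l<n. P i l * ?I $$ (l, j)) \<le> 0" if "i \<in> R" "i < n" for i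
      using that j by (auto simp: PI)
  qed
  have "(?I * ?T) $$ (i, j) = 0" if "i \<in> R" "j < n" "j \<notin> R" for i j
  proof -
    have "i < n" using that isolatedD(1)[OF R] by auto
    then have "(?I * ?T) $$ (i, j) = (\<Sum>l<n. ?I $$ (i, l) * ?T $$ (l, j))"
      using mult_mat_sum[OF inv(1) T _ that(2)] by blast
    also have "\<dots> = 0"
      using T0[OF _ that(2,3)] I0[OF that(1)] by (intro sum.neutral) auto
    finally show ?thesis .
  qed
  moreover have "R \<subset> {..<n}"
  proof -
    have "l \<notin> R" using isolatedD(3)[OF R, of l] b_pos(2) by linarith
    then show ?thesis using isolatedD(1)[OF R] b_pos(1) by blast
  qed
  moreover have "dim_row (?I * ?T) = n" using inv(1) by simp
  ultimately have "R \<noteq> {} \<and> R \<subset> {..<dim_row (?I * ?T)} \<and>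
      (\<forall>i\<in>R. \<forall>j\<in>{..<dim_row (?I * ?T)} - R. (?I * ?T) $$ (i, j) = 0)"
    using isolatedD(2)[OF R] by (metis DiffE lessThan_iff)
  then show False using irr unfolding irreducible_mat_def by blast
qed

text \<open>At an extremal index \<open>i\<close> of an isolated set, triangularity removes the
  off-diagonal elements that involve \<open>R\<close> and isolation those that involve outside
  indices. As \<open>P\<close> holds the whole diagonal, row \<open>i\<close> of the fixed point
  equation collapses to \<open>P i i * z i ^ k = 0\<close>, which is impossible.\<close>

lemma not_isolated_if_triangular:
  assumes z: "\<And>i. i < n \<Longrightarrow> 0 < z i"
    and fixpt: "\<And>i. i < n \<Longrightarrow> (\<Sum>j<n. P i j * z j ^ k) = tensor_form n k L i z + b i"
    and diag: "\<And>i. i < n \<Longrightarrow> P i i = A (replicate (Suc k) i)"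
    and tri: "strictly_upper_triangular (tensor_mat (Suc k) n
          (semi_symmetric (Suc k) (\<lambda>js. diagonal_part A js - A js)) (ones_vec n)) \<or>
        strictly_lower_triangular (tensor_mat (Suc k) n
          (semi_symmetric (Suc k) (\<lambda>js. diagonal_part A js - A js)) (ones_vec n))"
  shows "\<not> isolated R"
proof
  assume R: "isolated R"
  let ?B = "\<lambda>js. diagonal_part A js - A js"
  let ?T = "tensor_mat (Suc k) n (semi_symmetric (Suc k) ?B) (ones_vec n)"
  obtain s B where B: "\<And>i js. i < n \<Longrightarrow> js \<in> index_lists n k \<Longrightarrow>
      A (i # js) = s * identity_tensor (i # js) - B (i # js) \<and> 0 \<le> B (i # js)"
    using Z_tensor by blast
  have B0: "0 \<le> ?B (i # js)" if "i < n" "js \<in> index_lists n k" for i js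
    using B[OF that] by (simp add: diagonal_part_def identity_tensor_def)
  have T: "?T \<in> carrier_mat n n" by (simp add: tensor_mat_def)
  have finR: "finite R" using isolatedD(1)[OF R] finite_subset by blast
  \<comment> \<open>Strictly upper triangular: the largest index of \<open>R\<close>; strictly lower
    triangular: the smallest.\<close>
  have "\<exists>i\<in>R. \<forall>j\<in>R. ?T $$ (i, j) = 0"
    using tri
  proof
    assume up: "strictly_upper_triangular ?T"
    show ?thesis
    proof (rule bexI[of _ "Max R"], rule ballI)
      show "Max R \<in> R" using finR isolatedD(2)[OF R] by (rule Max_in)
      show "?T $$ (Max R, j) = 0" if "j \<in> R" for j
        using up T that \<open>Max R \<in> R\<close> isolatedD(1)[OF R] Max_ge[OF finR that]
        unfolding strictly_upper_triangular_def by auto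
    qed
  next
    assume low: "strictly_lower_triangular ?T"
    show ?thesis
    proof (rule bexI[of _ "Min R"], rule ballI)
      show "Min R \<in> R" using finR isolatedD(2)[OF R] by (rule Min_in)
      show "?T $$ (Min R, j) = 0" if "j \<in> R" for j
        using low T that \<open>Min R \<in> R\<close> isolatedD(1)[OF R] Min_le[OF finR that]
        unfolding strictly_lower_triangular_def by auto
    qed
  qed
  then obtain i where i: "i \<in> R" and Ti: "\<And>j. j \<in> R \<Longrightarrow> ?T $$ (i, j) = 0" by blast
  have i_n: "i < n" using i isolatedD(1)[OF R] by auto
  have Bi: "?B (i # js) = 0" if "js \<in> index_lists n k" "j \<in> set js" "j \<in> R" for j js
    using that B0[OF i_n] Ti isolatedD(1)[OF R]
    by (intro tensor_mat_semi_symmetric_eq_0D[where T = ?B and i = i and j = j and n = n and k = k] k i_n) auto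
  have const: "A (i # replicate k j) = P i j - L (i # replicate k j)" if "j < n" for j
    using split[OF i_n, of "replicate k j"] that k by (auto simp: index_lists_def)
  \<comment> \<open>The vanishing element is \<open>P i j - L (i # replicate k j)\<close> with a
    nonpositive first and a nonnegative second term, so both are zero.\<close>
  have off: "P i j = 0 \<and> L (i # replicate k j) = 0" if "j \<in> R" "j \<noteq> i" for j
  proof -
    have j: "j < n" using that isolatedD(1)[OF R] by auto
    have rep: "replicate k j \<in> index_lists n k" "j \<in> set (replicate k j)"
      using j k by (auto simp: index_lists_def)
    have "\<not> diagonal_index (i # replicate k j)"
      using k that(2) by (auto simp: diagonal_index_def Cons_replicate_eq replicate_eq_replicate)
    then have "P i j - L (i # replicate k j) = 0"
      using Bi[OF rep that(1)] const[OF j] by (simp add: diagonal_part_def)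
    moreover have "P i j \<le> 0" using P that(2) i_n j by (auto simp: semipositive_Z_def)
    moreover have "0 \<le> L (i # replicate k j)" by (rule L[OF i_n rep(1)])
    ultimately show ?thesis by linarith
  qed
  \<comment> \<open>Lists leaving \<open>R\<close> are covered by isolation, constant lists by
    \<open>off\<close> or, for the diagonal element, by \<open>diag\<close>; at a non-constant list
    \<open>L\<close> equals \<open>- A\<close>, which is zero by triangularity.\<close>
  have Li: "L (i # js) = 0" if js: "js \<in> index_lists n k" for js
  proof (cases "set js \<subseteq> R")
    case False
    then obtain j where "j \<in> set js" "j \<notin> R" by blast
    then show ?thesis using isolatedD(5)[OF R i _ _ js] index_lists_mem[OF js] by blast
  next
    case True
    have ne: "js \<noteq> []" using js k by (auto simp: index_lists_def)
    then have hd: "hd js \<in> set js" "hd js \<in> R" using True by auto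
    show ?thesis
    proof (cases "js = replicate k (hd js)")
      case const_js: True
      show ?thesis
      proof (cases "hd js = i")
        case True
        then show ?thesis using const[OF i_n] diag[OF i_n] const_js by simp
      next
        case False
        then show ?thesis using off[OF hd(2)] const_js by metis
      qed
    next
      case False
      have "\<not> diagonal_index (i # js)"
      proof
        assume "diagonal_index (i # js)"
        then obtain j where "i # js = replicate (Suc (length js)) j"
          by (auto simp: diagonal_index_def)
        then have "js = replicate k j" using js by (simp add: index_lists_def)
        then show False using False k by (metis hd_replicate less_numeral_extra(3))
      qed
      then have "A (i # js) = 0" using Bi[OF js hd] by (simp add: diagonal_part_def)
      then show ?thesis using split[OF i_n js] False by simp
    qed
  qed
  have "P i j * z j ^ k = (if j = i then P i i * z i ^ k else 0)" if "j < n" for j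
    using off[of j] isolatedD(4)[OF R i that(1)] by (cases "j \<in> R") auto
  then have "(\<Sum>j<n. P i j * z j ^ k) = (\<Sum>j<n. if j = i then P i i * z i ^ k else 0)"
    by (intro sum.cong) auto
  then have "(\<Sum>j<n. P i j * z j ^ k) = P i i * z i ^ k"
    using i_n by simp
  moreover have "tensor_form n k L i z + b i = 0"
    using Li isolatedD(3)[OF R i] by (simp add: tensor_form_def)
  ultimately have "P i i * z i ^ k = 0" using fixpt[OF i_n] by simp
  then show False using semipositive_Z_diag[OF P i_n] z[OF i_n] by simp
qed

text \<open>An index with nonzero \<open>b\<close> lies outside an isolated set, yet a nonzero
  element of \<open>A\<close> through it needs a contribution from \<open>L\<close> or, for a
  constant tail, from \<open>P\<close>; isolation forbids both.\<close>

lemma not_isolated_if_linked: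
  assumes link: "\<And>i. i < n \<Longrightarrow> b i = 0 \<Longrightarrow>
      \<exists>js\<in>index_lists n k. A (i # js) \<noteq> 0 \<and> (\<exists>j\<in>set js. b j \<noteq> 0)"
  shows "\<not> isolated R"
proof
  assume R: "isolated R"
  obtain i where i: "i \<in> R" "i < n" using isolatedD(1,2)[OF R] by blast
  obtain js j where js: "js \<in> index_lists n k" "A (i # js) \<noteq> 0" "j \<in> set js" "b j \<noteq> 0"
    using link[OF i(2) isolatedD(3)[OF R i(1)]] by blast
  have j: "j < n" "j \<notin> R" using index_lists_mem[OF js(1,3)] isolatedD(3)[OF R] js(4) by auto
  have "L (i # js) = 0" by (rule isolatedD(5)[OF R i(1) j js(1,3)])
  moreover have "js = replicate k (hd js) \<Longrightarrow> hd js = j"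
    using js(3) by (metis in_set_replicate)
  ultimately show False
    using split[OF i(2) js(1)] js(2) isolatedD(4)[OF R i(1) j] by (auto split: if_splits)
qed

section \<open>Behaviour of the iterates: rate, bounds, zero patterns and limit\<close>

lemma linear_convergence:
  fixes x :: "nat \<Rightarrow> nat \<Rightarrow> real"
  assumes "\<And>i. i < n \<Longrightarrow> 0 < z i"
    and "\<And>i. i < n \<Longrightarrow> (\<Sum>j<n. P i j * z j ^ k) = tensor_form n k L i z + b i"
    and "\<And>t i. i < n \<Longrightarrow> (\<Sum>j<n. P i j * x (Suc t) j ^ k) = tensor_form n k L i (x t) + b i"
    and "\<And>t i. i < n \<Longrightarrow> z i \<le> x t i"
    and "\<And>R. \<not> isolated R"
  shows "\<exists>c r. 0 < c \<and> 0 < r \<and> r < 1 \<and> (\<forall>t. \<forall>i<n. x t i - z i \<le> c * r ^ t)"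
proof (rule iteration_linear_convergence[where n = n and k = k and P = P and L = L and b = b
      and z = z and x = x, OF k P L b assms(1-4)])
  fix R assume "R \<subseteq> {..<n}" "R \<noteq> {}" "\<And>i. i \<in> R \<Longrightarrow> b i = 0"
    "\<And>i j. i \<in> R \<Longrightarrow> j < n \<Longrightarrow> j \<notin> R \<Longrightarrow> P i j = 0"
    "\<And>i j js. i \<in> R \<Longrightarrow> j < n \<Longrightarrow> j \<notin> R \<Longrightarrow> js \<in> index_lists n k \<Longrightarrow> j \<in> set js \<Longrightarrow> L (i # js) = 0"
  then have "isolated R" unfolding isolated_def by blast
  then show False using assms(5) by blast
qed

text \<open>Only inequalities are assumed, since the lemma is also applied to the iterates
  restricted to an index subset, which before stabilisation of the zero pattern need not satisfy the
  reduced recursion exactly.\<close>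

lemma iteration_lower:
  fixes x :: "nat \<Rightarrow> nat \<Rightarrow> real"
  assumes y: "\<And>i. i < n \<Longrightarrow> 0 \<le> y i"
    and x: "\<And>t i. i < n \<Longrightarrow> 0 \<le> x t i"
    and sub: "\<And>i. i < n \<Longrightarrow> (\<Sum>j<n. P i j * y j ^ k) \<le> tensor_form n k L i y + b i"
    and super: "\<And>t i. i < n \<Longrightarrow> tensor_form n k L i (x t) + b i \<le> (\<Sum>j<n. P i j * x (Suc t) j ^ k)"
    and start: "\<And>i. i < n \<Longrightarrow> y i \<le> x 0 i"
    and i: "i < n"
  shows "y i \<le> x t i"
  using i
proof (induction t arbitrary: i)
  case (Suc t)
  have "y i ^ k \<le> x (Suc t) i ^ k"
  proof (rule semipositive_Z_mono[OF P _ Suc.prems])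
    fix i assume i: "i < n"
    have "tensor_form n k L i y \<le> tensor_form n k L i (x t)"
      using L[OF i] y Suc.IH by (intro tensor_form_mono) auto
    then show "(\<Sum>j<n. P i j * y j ^ k) \<le> (\<Sum>j<n. P i j * x (Suc t) j ^ k)"
      using sub[OF i] super[OF i, of t] by linarith
  qed
  then show ?case using y[OF Suc.prems] x[OF Suc.prems] k by (simp add: power_mono_iff)
qed (rule start)

text \<open>The starting inequality says that the image of \<open>x 0\<close> under \<open>P\<close>
  dominates that of \<open>x 1\<close>; afterwards monotonicity of the form propagates the
  order.\<close>

lemma iteration_decreasing:
  fixes x :: "nat \<Rightarrow> nat \<Rightarrow> real"
  assumes x: "\<And>t i. i < n \<Longrightarrow> 0 \<le> x t i"
    and iter: "\<And>t i. i < n \<Longrightarrow> (\<Sum>j<n. P i j * x (Suc t) j ^ k) = tensor_form n k L i (x t) + b i"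
    and start: "\<And>i. i < n \<Longrightarrow> b i \<le> tensor_form n k A i (x 0)"
    and i: "i < n"
  shows "x (Suc t) i \<le> x t i"
  using i
proof (induction t arbitrary: i)
  case 0
  have "x (Suc 0) i ^ k \<le> x 0 i ^ k"
  proof (rule semipositive_Z_mono[OF P _ 0])
    fix i assume i: "i < n"
    show "(\<Sum>j<n. P i j * x (Suc 0) j ^ k) \<le> (\<Sum>j<n. P i j * x 0 j ^ k)"
      using iter[OF i, of 0] start[OF i] form_eq[OF i, of "x 0"] by linarith
  qed
  then show ?case using x[OF 0] k by (simp add: power_mono_iff)
next
  case (Suc t)
  have "x (Suc (Suc t)) i ^ k \<le> x (Suc t) i ^ k"
  proof (rule semipositive_Z_mono[OF P _ Suc.prems])
    fix i assume i: "i < n"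
    have "tensor_form n k L i (x (Suc t)) \<le> tensor_form n k L i (x t)"
      using L[OF i] x Suc.IH by (intro tensor_form_mono) auto
    then show "(\<Sum>j<n. P i j * x (Suc (Suc t)) j ^ k) \<le> (\<Sum>j<n. P i j * x (Suc t) j ^ k)"
      unfolding iter[OF i] by linarith
  qed
  then show ?case using x[OF Suc.prems] k by (simp add: power_mono_iff)
qed

text \<open>If entry \<open>i\<close> were zero, only off-diagonal terms would remain in row
  \<open>i\<close>, giving a value \<open>\<le> 0\<close> where at least \<open>b i > 0\<close> is
  required.\<close>

lemma iteration_pos:
  fixes x :: "nat \<Rightarrow> nat \<Rightarrow> real"
  assumes x: "\<And>t i. i < n \<Longrightarrow> 0 \<le> x t i"
    and iter: "\<And>t i. i < n \<Longrightarrow> (\<Sum>j<n. P i j * x (Suc t) j ^ k) = tensor_form n k L i (x t) + b i"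
    and i: "i < n" "0 < b i"
  shows "0 < x (Suc t) i"
proof (rule ccontr)
  assume "\<not> 0 < x (Suc t) i"
  then have zero: "x (Suc t) i = 0" using x[OF i(1), of "Suc t"] by linarith
  have "(\<Sum>j<n. P i j * x (Suc t) j ^ k) \<le> 0"
  proof (rule sum_nonpos)
    fix j assume j: "j \<in> {..<n}"
    show "P i j * x (Suc t) j ^ k \<le> 0"
    proof (cases "j = i")
      case True
      then show ?thesis using zero k by (simp add: zero_power)
    next
      case False
      then show ?thesis using P i(1) j x unfolding semipositive_Z_def
        by (intro mult_nonpos_nonneg) auto
    qed
  qed
  moreover have "0 \<le> tensor_form n k L i (x t)" using L[OF i(1)] x by (intro tensor_form_nonneg) auto
  ultimately show False using iter[OF i(1), of t] i(2) by linarith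
qed

text \<open>When no new zero appears, \<open>x t \<le> c * x (Suc t)\<close> for some
  \<open>c\<close>. Homogeneity and inverse positivity carry this to the next pair of iterates, so a
  zero of \<open>x (Suc (Suc t))\<close> was one of \<open>x (Suc t)\<close>.\<close>

lemma iteration_zero_pattern_stable:
  fixes x :: "nat \<Rightarrow> nat \<Rightarrow> real"
  assumes x: "\<And>t i. i < n \<Longrightarrow> 0 \<le> x t i"
    and iter: "\<And>t i. i < n \<Longrightarrow> (\<Sum>j<n. P i j * x (Suc t) j ^ k) = tensor_form n k L i (x t) + b i"
    and same: "\<And>j. j < n \<Longrightarrow> x (Suc t) j = 0 \<Longrightarrow> x t j = 0"
    and i: "i < n" "x (Suc (Suc t)) i = 0"
  shows "x (Suc t) i = 0"
proof -
  obtain c0 where c0: "0 < c0" "\<And>j. j < n \<Longrightarrow> x t j / x (Suc t) j \<le> c0"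
    using finite_bound[of n "\<lambda>j. x t j / x (Suc t) j"] by blast
  \<comment> \<open>Taking \<open>c \<ge> 1\<close> allows the inhomogeneous term to be absorbed, as
    \<open>b i \<le> c ^ k * b i\<close>.\<close>
  define c where "c = max 1 c0"
  have c: "1 \<le> c" "c0 \<le> c" by (simp_all add: c_def)
  have le: "x t j \<le> c * x (Suc t) j" if j: "j < n" for j
  proof (cases "x (Suc t) j = 0")
    case True
    then show ?thesis using same[OF j] by simp
  next
    case False
    then have pos: "0 < x (Suc t) j" using x[OF j, of "Suc t"] by linarith
    have "x t j / x (Suc t) j \<le> c" using c0(2)[OF j] c(2) by linarith
    then show ?thesis using pos by (simp add: divide_le_eq)
  qed
  have "x (Suc t) i ^ k \<le> c ^ k * x (Suc (Suc t)) i ^ k"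
  proof (rule semipositive_Z_mono[OF P _ i(1)])
    fix i assume i: "i < n"
    have "tensor_form n k L i (x t) \<le> tensor_form n k L i (\<lambda>j. c * x (Suc t) j)"
      using L[OF i] x le by (intro tensor_form_mono) auto
    also have "\<dots> = c ^ k * tensor_form n k L i (x (Suc t))" by (rule tensor_form_scale)
    finally have "tensor_form n k L i (x t) \<le> c ^ k * tensor_form n k L i (x (Suc t))" .
    moreover have "1 * b i \<le> c ^ k * b i"
      using b[OF i] c(1) by (intro mult_right_mono) auto
    ultimately have "(\<Sum>j<n. P i j * x (Suc t) j ^ k) \<le> c ^ k * (\<Sum>j<n. P i j * x (Suc (Suc t)) j ^ k)"
      unfolding iter[OF i] by (simp add: distrib_left)
    then show "(\<Sum>j<n. P i j * x (Suc t) j ^ k) \<le> (\<Sum>j<n. P i j * (c ^ k * x (Suc (Suc t)) j ^ k))"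
      by (simp add: sum_distrib_left mult_ac)
  qed
  then have "x (Suc t) i ^ k \<le> 0" using i(2) k by (simp add: zero_power)
  then have "x (Suc t) i ^ k = 0" using x[OF i(1), of "Suc t"] by (meson order_antisym zero_le_power)
  then show ?thesis by simp
qed

lemma iteration_limit:
  fixes x :: "nat \<Rightarrow> nat \<Rightarrow> real"
  assumes x: "\<And>t i. i < n \<Longrightarrow> 0 \<le> x t i"
    and iter: "\<And>t i. i < n \<Longrightarrow> (\<Sum>j<n. P i j * x (Suc t) j ^ k) = tensor_form n k L i (x t) + b i"
    and dec: "\<And>t i. i < n \<Longrightarrow> x (Suc t) i \<le> x t i"
  obtains l where "\<And>i. i < n \<Longrightarrow> (\<lambda>t. x t i) \<longlonglongrightarrow> l i"
    "\<And>i. i < n \<Longrightarrow> 0 \<le> l i" "\<And>i. i < n \<Longrightarrow> tensor_form n k A i l = b i"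
proof -
  have "\<exists>y. (\<lambda>t. x t i) \<longlonglongrightarrow> y" if i: "i < n" for i
  proof -
    have "decseq (\<lambda>t. x t i)" using dec[OF i] by (intro decseq_SucI)
    then show ?thesis using decseq_convergent[of "\<lambda>t. x t i" 0] x[OF i] by blast
  qed
  then obtain l where l: "\<And>i. i < n \<Longrightarrow> (\<lambda>t. x t i) \<longlonglongrightarrow> l i" by metis
  have l0: "0 \<le> l i" if "i < n" for i
    using l[OF that] by (rule LIMSEQ_le_const) (auto intro: x[OF that])
  have prod: "(\<lambda>t. \<Prod>j\<leftarrow>js. x t j) \<longlonglongrightarrow> (\<Prod>j\<leftarrow>js. l j)" if "set js \<subseteq> {..<n}" for js
    using that
  proof (induction js)
    case (Cons a js)
    then show ?case by (auto intro!: tendsto_mult l)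
  qed simp
  have "tensor_form n k A i l = b i" if i: "i < n" for i
  proof -
    have "(\<lambda>t. tensor_form n k L i (x t) + b i) \<longlonglongrightarrow> tensor_form n k L i l + b i"
      unfolding tensor_form_def
      by (intro tendsto_intros prod) (auto simp: index_lists_def)
    moreover have "(\<lambda>t. x (Suc t) j) \<longlonglongrightarrow> l j" if "j < n" for j
      using LIMSEQ_Suc[OF l[OF that]] .
    then have "(\<lambda>t. \<Sum>j<n. P i j * x (Suc t) j ^ k) \<longlonglongrightarrow> (\<Sum>j<n. P i j * l j ^ k)"
      by (intro tendsto_intros) auto
    ultimately have "tensor_form n k L i l + b i = (\<Sum>j<n. P i j * l j ^ k)"
      unfolding iter[OF i] by (rule LIMSEQ_unique)
    then show ?thesis using form_eq[OF i, of l] by linarith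
  qed
  with l l0 show ?thesis using that by blast
qed

end

section \<open>The level-1 splitting\<close>

lemma tensor_vec_index:
  "i < n \<Longrightarrow> tensor_vec m n A x $ i = tensor_form n (m - 1) A i (\<lambda>j. x $ j)"
  by (simp add: tensor_vec_def tensor_form_def)

lemma level1_index_Cons:
  assumes "0 < k" "js \<in> index_lists n k"
  shows "level1_index (i # js) \<longleftrightarrow> js = replicate k (hd js)"
proof -
  have "level1_index (i # js) \<longleftrightarrow> (\<exists>j. js = replicate k j)"
    using assms(2) by (simp add: level1_index_def index_lists_def)
  also have "\<dots> \<longleftrightarrow> js = replicate k (hd js)"
    using assms(1) by (metis hd_replicate less_numeral_extra(3))
  finally show ?thesis .
qed

text \<open>At constant tails \<open>A\<close> equals \<open>P - Q\<close> by the majorization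
  matrix. At the other positions \<open>level1_L\<close> equals \<open>- A\<close>, and such
  positions are off-diagonal, where an M-tensor is nonpositive.\<close>

lemma M_splitting_level1:
  assumes m: "m = Suc k" "0 < k" and n: "0 < n"
    and A: "nonsingular_M_tensor m n A"
    and b: "b \<in> carrier_vec n" "0\<^sub>v n \<le> b"
    and PQ: "P \<in> carrier_mat n n" "Q \<in> carrier_mat n n"
    and maj: "majorization_mat m n A = P - Q"
    and P: "nonsingular_M_matrix n P" and Q: "0\<^sub>m n n \<le> Q"
  shows "M_splitting n k A (level1_L A Q) (\<lambda>i j. P $$ (i, j)) (\<lambda>i. b $ i)"
proof
  show "0 < k" by (rule m(2))
  show "semipositive_Z n (\<lambda>i j. P $$ (i, j))" by (rule nonsingular_M_matrix_semipositive[OF P n])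
  show "0 \<le> b $ i" if "i < n" for i using b that by (auto simp: less_eq_vec_def)
  obtain s B where nonneg: "nonneg_tensor m n B"
    and sB: "\<And>js. js \<in> index_lists n m \<Longrightarrow> A js = s * identity_tensor js - B js"
    using A unfolding nonsingular_M_tensor_def by blast
  have B: "A (i # js) = s * identity_tensor (i # js) - B (i # js) \<and> 0 \<le> B (i # js)"
    if "i < n" "js \<in> index_lists n k" for i js
  proof -
    have "i # js \<in> index_lists n m" using that m(1) by (auto simp: index_lists_def)
    then show ?thesis using sB nonneg unfolding nonneg_tensor_def by blast
  qed
  then show "\<exists>s B. \<forall>i<n. \<forall>js\<in>index_lists n k.
      A (i # js) = s * identity_tensor (i # js) - B (i # js) \<and> 0 \<le> B (i # js)" by blast
  fix i js assume i: "i < n" and js: "js \<in> index_lists n k"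
  have ne: "js \<noteq> []" using js m(2) by (auto simp: index_lists_def)
  then have hd: "hd js < n" "js ! 0 = hd js"
    using hd_in_set index_lists_mem[OF js] by (auto simp: hd_conv_nth)
  have L: "level1_L A Q (i # js) = (if js = replicate k (hd js) then Q $$ (i, hd js) else - A (i # js))"
    using level1_index_Cons[OF m(2) js, of i] hd
    by (simp add: level1_L_def level1_N_def level1_M_def)
  have "majorization_mat m n A $$ (i, hd js) = P $$ (i, hd js) - Q $$ (i, hd js)"
    using PQ i hd(1) by (simp add: maj)
  then have const: "A (i # replicate k (hd js)) = P $$ (i, hd js) - Q $$ (i, hd js)"
    using i hd(1) m(1) by (simp add: majorization_mat_def)
  show "A (i # js) = (if js = replicate k (hd js) then P $$ (i, hd js) else 0) - level1_L A Q (i # js)"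
    using L const by auto
  show "0 \<le> level1_L A Q (i # js)"
  proof (cases "js = replicate k (hd js)")
    case True
    then show ?thesis using L Q i hd(1) by (auto simp: less_eq_mat_def)
  next
    case False
    have "\<not> diagonal_index (i # js)"
    proof
      assume "diagonal_index (i # js)"
      then obtain j where "i # js = replicate (Suc (length js)) j"
        by (auto simp: diagonal_index_def)
      then have "js = replicate k j" using js by (simp add: index_lists_def)
      then show False using False m(2) by (metis hd_replicate less_numeral_extra(3))
    qed
    then show ?thesis using L False B[OF i js] by (simp add: identity_tensor_def)
  qed
qed

text \<open>\<open>level1_N\<close> vanishes at constant tails, so the contributions of
  \<open>Q\<close> and of \<open>level1_N\<close> occupy disjoint sets of index lists.\<close>

lemma level1_L_form:
  assumes m: "m = Suc k" "0 < k" and i: "i < n"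
    and Q: "Q \<in> carrier_mat n n" and v: "v \<in> carrier_vec n"
  shows "(Q *\<^sub>v vec_pow v k) $ i + tensor_vec m n (level1_N A) v $ i =
    tensor_form n k (level1_L A Q) i (\<lambda>j. v $ j)"
proof -
  have "level1_L A Q (i # js) * (\<Prod>j\<leftarrow>js. v $ j) =
      (if js = replicate k (hd js) then Q $$ (i, hd js) * (\<Prod>j\<leftarrow>js. v $ j) else 0) +
      level1_N A (i # js) * (\<Prod>j\<leftarrow>js. v $ j)"
    if js: "js \<in> index_lists n k" for js
  proof -
    have "js \<noteq> []" using js m(2) by (auto simp: index_lists_def)
    then show ?thesis using level1_index_Cons[OF m(2) js, of i]
      by (simp add: level1_L_def level1_N_def level1_M_def hd_conv_nth)
  qed
  then have "tensor_form n k (level1_L A Q) i (\<lambda>j. v $ j) =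
      (\<Sum>j<n. Q $$ (i, j) * (v $ j) ^ k) + tensor_form n k (level1_N A) i (\<lambda>j. v $ j)"
    using m(2) by (simp add: tensor_form_def sum.distrib sum_constant_lists prod_list_replicate)
  moreover have "(Q *\<^sub>v vec_pow v k) $ i = (\<Sum>j<n. Q $$ (i, j) * (v $ j) ^ k)"
    using Q v i by (subst mult_mat_vec_sum[OF Q]) (auto simp: vec_pow_def intro!: sum.cong)
  ultimately show ?thesis using i m(1) by (simp add: tensor_vec_index)
qed

section \<open>Vectors, chains of index sets and linear convergence\<close>

lemma mult_mat_vec_pow:
  assumes "M \<in> carrier_mat n n" "v \<in> carrier_vec n" "i < n"
  shows "(M *\<^sub>v vec_pow v k) $ i = (\<Sum>j<n. M $$ (i, j) * (v $ j) ^ k)"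
  using assms by (subst mult_mat_vec_sum[OF assms(1)]) (auto simp: vec_pow_def intro!: sum.cong)

lemma vec_nonneg_index: "0\<^sub>v n \<le> v \<Longrightarrow> i < n \<Longrightarrow> 0 \<le> v $ i"
  for v :: "real vec"
  by (auto simp: less_eq_vec_def)

lemma vec_leI:
  fixes v w :: "real vec"
  assumes "v \<in> carrier_vec n" "w \<in> carrier_vec n" "\<And>i. i < n \<Longrightarrow> v $ i \<le> w $ i"
  shows "v \<le> w"
  using assms by (auto simp: less_eq_vec_def)

text \<open>Each strict inclusion adds an index, so \<open>n\<close> of them would give a set with
  at least \<open>n\<close> elements. Properness of all sets is what gives the bound
  \<open>n - 1\<close> instead of \<open>n\<close>.\<close>

lemma increasing_chain_stabilises:
  assumes mono: "\<And>t. Z t \<subseteq> Z (Suc t)" and proper: "\<And>t. Z t \<subset> {..<n}"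
  shows "\<exists>t\<le>n - 1. Z t = Z (Suc t)"
proof (rule ccontr)
  assume no: "\<not> (\<exists>t\<le>n - 1. Z t = Z (Suc t))"
  have fin: "finite (Z t)" for t using proper[of t] finite_subset by blast
  have "t \<le> card (Z t)" if "t \<le> n" for t
    using that
  proof (induction t)
    case (Suc t)
    then have "Z t \<subset> Z (Suc t)" using no mono[of t] by auto
    then have "card (Z t) < card (Z (Suc t))" by (rule psubset_card_mono[OF fin])
    with Suc show ?case by simp
  qed simp
  then have "n \<le> card (Z n)" by simp
  moreover have "card (Z n) < n" using psubset_card_mono[OF _ proper[of n]] by simp
  ultimately show False by simp
qed

lemma vnorm_L2_set: "vnorm v = L2_set (\<lambda>i. v $ i) {..<dim_vec v}"
  by (simp add: vnorm_def L2_set_def scalar_prod_def power2_eq_square atLeast0LessThan)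

lemma subvec_index:
  assumes "v \<in> carrier_vec n" "J \<subseteq> {..<n}"
  shows "subvec v J \<in> carrier_vec (card J)" "i < card J \<Longrightarrow> subvec v J $ i = v $ pick J i"
proof -
  have "{i. i < dim_vec v \<and> i \<in> J} = J" using assms by auto
  then show "subvec v J \<in> carrier_vec (card J)" "i < card J \<Longrightarrow> subvec v J $ i = v $ pick J i"
    by (simp_all add: subvec_def)
qed

lemma submatrix_pick:
  assumes "M \<in> carrier_mat n n" "J \<subseteq> {..<n}"
  shows "submatrix M J J \<in> carrier_mat (card J) (card J)"
    "i < card J \<Longrightarrow> j < card J \<Longrightarrow> submatrix M J J $$ (i, j) = M $$ (pick J i, pick J j)"
proof -
  have "{i. i < dim_row M \<and> i \<in> J} = J" "{i. i < dim_col M \<and> i \<in> J} = J" using assms by auto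
  then show "submatrix M J J \<in> carrier_mat (card J) (card J)"
    "i < card J \<Longrightarrow> j < card J \<Longrightarrow> submatrix M J J $$ (i, j) = M $$ (pick J i, pick J j)"
    by (simp_all add: submatrix_def)
qed

lemma vnorm_subvec:
  assumes v: "v \<in> carrier_vec n" and w: "w \<in> carrier_vec n" and J: "J \<subseteq> {..<n}"
    and eq: "\<And>j. j < n \<Longrightarrow> j \<notin> J \<Longrightarrow> v $ j = w $ j"
  shows "vnorm (subvec v J - subvec w J) = vnorm (v - w)"
proof -
  have "(\<Sum>j<n. ((v - w) $ j)\<^sup>2) = (\<Sum>j<card J. ((v - w) $ pick J j)\<^sup>2)"
    using v w eq by (subst sum_pick[OF J]) (auto intro!: sum.neutral)
  also have "\<dots> = (\<Sum>j<card J. ((subvec v J - subvec w J) $ j)\<^sup>2)"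
    using subvec_index[OF v J] subvec_index[OF w J] pick_less(1)[OF J] v w
    by (intro sum.cong) auto
  finally show ?thesis
    using v w subvec_index(1)[OF v J] subvec_index(1)[OF w J]
    by (simp add: vnorm_L2_set L2_set_def)
qed

text \<open>The finitely many terms before \<open>t0\<close> are absorbed by enlarging the
  constant.\<close>

lemma linearly_convergent_from_iff:
  assumes "\<And>t. t0 \<le> t \<Longrightarrow> vnorm (x t - y) = vnorm (x' t - y')"
  shows "linearly_convergent_from 0 x y \<longleftrightarrow> linearly_convergent_from t0 x' y'"
proof
  assume "linearly_convergent_from 0 x y"
  then obtain C r where "0 < C" "0 < r" "r < 1" "\<And>t. vnorm (x t - y) \<le> C * r ^ t"
    unfolding linearly_convergent_from_def by auto
  then show "linearly_convergent_from t0 x' y'"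
    unfolding linearly_convergent_from_def using assms by (metis (no_types))
next
  assume "linearly_convergent_from t0 x' y'"
  then obtain C r where C: "0 < C" "0 < r" "r < 1" "\<And>t. t0 \<le> t \<Longrightarrow> vnorm (x t - y) \<le> C * r ^ t"
    unfolding linearly_convergent_from_def using assms by auto
  obtain c where c: "0 < c" "\<And>t. t < t0 \<Longrightarrow> vnorm (x t - y) / r ^ t \<le> c"
    using finite_bound[of t0 "\<lambda>t. vnorm (x t - y) / r ^ t"] by blast
  have "vnorm (x t - y) \<le> (C + c) * r ^ t" for t
  proof (cases "t0 \<le> t")
    case True
    have "0 \<le> c * r ^ t" using c(1) C(2) by simp
    then show ?thesis using C(4)[OF True] by (simp add: distrib_right)
  next
    case False
    then have "vnorm (x t - y) \<le> c * r ^ t" using c(2)[of t] C(2) by (simp add: divide_le_eq)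
    moreover have "0 \<le> C * r ^ t" using C(1,2) by simp
    ultimately show ?thesis by (simp add: distrib_right)
  qed
  then show "linearly_convergent_from 0 x y"
    unfolding linearly_convergent_from_def using C c(1) by (intro exI[of _ "C + c"] exI[of _ r]) auto
qed

lemma linearly_convergent_fromI:
  assumes c: "0 < c" "0 < r" "r < 1"
    and v: "\<And>t. v t \<in> carrier_vec n" "w \<in> carrier_vec n"
    and le: "\<And>t i. i < n \<Longrightarrow> \<bar>v (t0 + t) $ i - w $ i\<bar> \<le> c * r ^ t"
  shows "linearly_convergent_from t0 v w"
proof -
  \<comment> \<open>Division by \<open>r ^ t0\<close> undoes the index shift; \<open>n + 1\<close>
    instead of \<open>n\<close> keeps \<open>C\<close> positive in dimension 0.\<close>
  define C where "C = (n + 1) * (c / r ^ t0)"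
  have "vnorm (v t - w) \<le> C * r ^ t" if t: "t0 \<le> t" for t
  proof -
    have "dim_vec (v t - w) = n" using v by simp
    then have "vnorm (v t - w) \<le> (\<Sum>i<n. \<bar>(v t - w) $ i\<bar>)"
      using L2_set_le_sum_abs[of "\<lambda>i. (v t - w) $ i" "{..<n}"] by (simp only: vnorm_L2_set)
    also have "\<dots> \<le> (\<Sum>i<n. c * r ^ (t - t0))"
      using le[of _ "t - t0"] v t by (intro sum_mono) auto
    also have "\<dots> \<le> (n + 1) * (c * r ^ (t - t0))"
      using c by (simp add: distrib_right)
    also have "\<dots> = C * r ^ t"
      using c(2) t by (simp add: C_def power_diff)
    finally show ?thesis .
  qed
  moreover have "0 < C" using c by (simp add: C_def)
  ultimately show ?thesis unfolding linearly_convergent_from_def using c by blast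
qed

text \<open>The recursion is implicit, so the reduced iteration is expressed by an equivalence over
  all sequences \<open>y\<close>: from \<open>k0\<close> on it has exactly one nonnegative solution,
  and values before \<open>k0\<close> are left free. The equivalence for the maximal solution
  likewise contains existence and uniqueness.\<close>

theorem theorem15:
  fixes m n :: nat and A :: tensor and b xmax :: "real vec" and P Q :: "real mat"
    and x :: "nat \<Rightarrow> real vec"
  assumes "m \<ge> 2" and "n \<ge> 1"
    and "nonsingular_M_tensor m n A"
    and "b \<in> carrier_vec n" and "0\<^sub>v n \<le> b" and "b \<noteq> 0\<^sub>v n"
    and "maximal_nonneg_solution m n A b xmax"
    and "P \<in> carrier_mat n n" and "Q \<in> carrier_mat n n"
    and "majorization_mat m n A = P - Q"
    and "nonsingular_M_matrix n P" and "0\<^sub>m n n \<le> Q"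
    and "vec_less (0\<^sub>v n) (x 0)"
    and "vec_less (0\<^sub>v n) (tensor_vec m n A (x 0))" and "b \<le> tensor_vec m n A (x 0)"
    and "\<forall>k. x k \<in> carrier_vec n \<and> 0\<^sub>v n \<le> x k"
    and "\<forall>k. P *\<^sub>v vec_pow (x (Suc k)) (m - 1) =
           Q *\<^sub>v vec_pow (x k) (m - 1) + tensor_vec m n (level1_N A) (x k) + b"
  shows "\<exists>k0. k0 \<le> n - 1 \<and>
    zero_pattern (x k0) = zero_pattern (x (Suc k0)) \<and>
    (\<forall>k<k0. zero_pattern (x k) \<noteq> zero_pattern (x (Suc k))) \<and>
    (\<forall>k\<ge>k0. zero_pattern (x k) = zero_pattern (x k0)) \<and>
    (let I0 = {i. i < n \<and> b $ i = 0};
         I = zero_pattern (x k0);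
         Ic = {..<n} - I;
         n' = card Ic;
         A' = subtensor A Ic;
         b' = subvec b Ic;
         P' = submatrix P Ic Ic;
         L' = subtensor (level1_L A Q) Ic;
         x' = (\<lambda>k. subvec (x k) Ic);
         xmax' = subvec xmax Ic;
         B' = (\<lambda>js. diagonal_part A' js - A' js)
     in
       I \<subseteq> I0 \<and>
       (\<forall>y. ((\<forall>k\<ge>k0. y k \<in> carrier_vec n' \<and> 0\<^sub>v n' \<le> y k) \<and>
             y k0 = subvec (x k0) Ic \<and>
             (\<forall>k\<ge>k0. P' *\<^sub>v vec_pow (y (Suc k)) (m - 1) = tensor_vec m n' L' (y k) + b'))
            \<longleftrightarrow> (\<forall>k\<ge>k0. y k = x' k)) \<and>
       (\<forall>y. maximal_nonneg_solution m n' A' b' y \<longleftrightarrow> y = xmax') \<and>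
       (linearly_convergent_from 0 x xmax \<longleftrightarrow> linearly_convergent_from k0 x' xmax') \<and>
       (vec_less (0\<^sub>v n') xmax' \<and>
         (vec_less (0\<^sub>v n') (the (mat_inverse P') *\<^sub>v b') \<or>
          irreducible_mat (the (mat_inverse P') * tensor_mat m n' (semi_symmetric m L') (ones_vec n')) \<or>
          ((\<forall>i<n'. P' $$ (i, i) = A' (replicate m i)) \<and>
             (strictly_upper_triangular (tensor_mat m n' (semi_symmetric m B') (ones_vec n')) \<or>
              strictly_lower_triangular (tensor_mat m n' (semi_symmetric m B') (ones_vec n')))) \<or>
          (\<forall>i\<in>I0 \<inter> Ic. \<exists>js. length js = m - 1 \<and> set js \<subseteq> Ic \<and> A (i # js) \<noteq> 0 \<and>
             (\<exists>j\<in>set js. j \<notin> I0))) \<longrightarrow>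
          linearly_convergent_from k0 x' xmax'))"
proof -

  \<comment> \<open>Decrease of the iterates to the maximal solution\<close>
  define k where "k = m - 1"
  have m: "m = Suc k" and k: "0 < k" and m1: "m - 1 = k" "m - Suc 0 = k" using assms(1) by (simp_all add: k_def)
  have n: "0 < n" using assms(2) by simp
  note bc = assms(4) and xmax = assms(7) and Pc = assms(8) and Qc = assms(9)
  define L where "L = level1_L A Q"
  interpret S: M_splitting n k A L "\<lambda>i j. P $$ (i, j)" "\<lambda>i. b $ i"
    unfolding L_def by (rule M_splitting_level1[OF m k n assms(3) bc assms(5) Pc Qc assms(10-12)])
  have xc: "x t \<in> carrier_vec n" for t using assms(16) by blast
  have x_nonneg: "0 \<le> x t $ i" if "i < n" for t i
    using assms(16) that vec_nonneg_index by blast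
  have iter: "(\<Sum>j<n. P $$ (i, j) * (x (Suc t) $ j) ^ k) = tensor_form n k L i (\<lambda>j. x t $ j) + b $ i"
    if i: "i < n" for t i
  proof -
    have "(P *\<^sub>v vec_pow (x (Suc t)) k) $ i =
        (Q *\<^sub>v vec_pow (x t) k + tensor_vec m n (level1_N A) (x t) + b) $ i"
      using assms(17) unfolding m1 by metis
    also have "\<dots> = (Q *\<^sub>v vec_pow (x t) k) $ i + tensor_vec m n (level1_N A) (x t) $ i + b $ i"
      using i bc Qc by (simp add: tensor_vec_def)
    finally show ?thesis
      unfolding mult_mat_vec_pow[OF Pc xc i] level1_L_form[OF m k i Qc xc] L_def .
  qed
  have start: "0 < x 0 $ i" "0 < tensor_form n k A i (\<lambda>j. x 0 $ j)"
      "b $ i \<le> tensor_form n k A i (\<lambda>j. x 0 $ j)" if "i < n" for i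
    using assms(13-15) xc[of 0] that
    by (auto simp: vec_less_def less_eq_vec_def tensor_vec_def tensor_form_def m1)
  have xmc: "xmax \<in> carrier_vec n"
    using xmax by (simp add: maximal_nonneg_solution_def nonneg_solution_def)
  have xm_nonneg: "0 \<le> xmax $ i" if "i < n" for i
    using xmax that xmc
    by (auto simp: maximal_nonneg_solution_def nonneg_solution_def less_eq_vec_def)
  have xm_sol: "tensor_form n k A i (\<lambda>j. xmax $ j) = b $ i" if "i < n" for i
    using xmax that tensor_vec_index[OF that, of m A xmax]
    by (simp add: maximal_nonneg_solution_def nonneg_solution_def m1)
  \<comment> \<open>The tensor sends \<open>xmax\<close> to \<open>b\<close>, and sends
    \<open>x 0\<close> to a positive vector that is at least \<open>b\<close>; comparison thus
    starts the induction.\<close>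
  have xm_le: "xmax $ i \<le> x t $ i" if "i < n" for t i
  proof (rule S.iteration_lower[where y = "\<lambda>j. xmax $ j" and x = "\<lambda>t j. x t $ j", OF _ _ _ _ _ that])
    show "(\<Sum>j<n. P $$ (i, j) * (xmax $ j) ^ k) \<le> tensor_form n k L i (\<lambda>j. xmax $ j) + b $ i"
      if "i < n" for i
      using S.form_eq[OF that, of "\<lambda>j. xmax $ j"] xm_sol[OF that] by simp
    show "xmax $ i \<le> x 0 $ i" if "i < n" for i
      by (rule S.comparison[where f = "\<lambda>j. xmax $ j" and g = "\<lambda>j. x 0 $ j", OF _ _ _ that])
        (simp_all add: start xm_nonneg xm_sol)
  qed (simp_all add: xm_nonneg x_nonneg iter)
  have dec: "x (Suc t) $ i \<le> x t $ i" if "i < n" for t i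
    by (rule S.iteration_decreasing[where x = "\<lambda>t j. x t $ j", OF x_nonneg iter start(3) that])
  \<comment> \<open>The limit of the decreasing iterates is a nonnegative solution, hence at most
    \<open>xmax\<close>; as all iterates lie above \<open>xmax\<close>, the two coincide.\<close>
  obtain l where l: "\<And>i. i < n \<Longrightarrow> (\<lambda>t. x t $ i) \<longlonglongrightarrow> l i" "\<And>i. i < n \<Longrightarrow> 0 \<le> l i"
    "\<And>i. i < n \<Longrightarrow> tensor_form n k A i l = b $ i"
    using S.iteration_limit[where x = "\<lambda>t j. x t $ j", OF x_nonneg iter dec] by blast
  have "tensor_form n k A i (\<lambda>j. vec n l $ j) = b $ i" if "i < n" for i
    using l(3)[OF that] by (subst tensor_form_cong[where B = A and g = l]) auto
  then have "nonneg_solution m n A b (vec n l)"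
    using l(2) bc by (auto simp: nonneg_solution_def less_eq_vec_def tensor_vec_index m1
        intro!: eq_vecI simp: tensor_vec_def[of m n A "vec n l", THEN arg_cong[of _ _ dim_vec]])
  then have "vec n l \<le> xmax" using xmax by (simp add: maximal_nonneg_solution_def)
  then have l_le: "l i \<le> xmax $ i" if "i < n" for i using that xmc by (auto simp: less_eq_vec_def)
  have x_lim: "(\<lambda>t. x t $ i) \<longlonglongrightarrow> xmax $ i" if "i < n" for i
  proof -
    have "xmax $ i \<le> l i" using l(1)[OF that] by (rule LIMSEQ_le_const) (auto intro: xm_le[OF that])
    then show ?thesis using l(1)[OF that] l_le[OF that] by simp
  qed

  \<comment> \<open>Stabilisation of the zero patterns\<close>
  have zp: "zero_pattern (x t) = {i. i < n \<and> x t $ i = 0}" for t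
    using xc[of t] by (auto simp: zero_pattern_def)
  have zp_mono: "zero_pattern (x t) \<subseteq> zero_pattern (x (Suc t))" for t
  proof
    fix i assume "i \<in> zero_pattern (x t)"
    then have "i < n" "x t $ i = 0" by (auto simp: zp)
    then show "i \<in> zero_pattern (x (Suc t))"
      using dec[of i t] x_nonneg[of i "Suc t"] by (simp add: zp)
  qed
  have b_pos: "0 < x t $ i" if "i < n" "0 < b $ i" for t i
    using start(1)[OF that(1)] S.iteration_pos[where x = "\<lambda>t j. x t $ j", OF x_nonneg iter that]
    by (cases t) auto
  have b_nonneg: "0 \<le> b $ i" if "i < n" for i by (rule S.b[OF that])
  \<comment> \<open>An index where every iterate stays positive: it keeps the zero patterns proper
    and later supplies a positive entry of the reduced right-hand side.\<close>
  obtain p where p: "p < n" "0 < b $ p"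
  proof -
    have "\<exists>i<n. b $ i \<noteq> 0"
      using assms(6) bc by (metis eq_vecI carrier_vecD index_zero_vec)
    then show ?thesis using that b_nonneg by (metis less_le)
  qed
  have zp_proper: "zero_pattern (x t) \<subset> {..<n}" for t
  proof -
    have "p \<notin> zero_pattern (x t)" using b_pos[OF p, of t] by (simp add: zp)
    moreover have "zero_pattern (x t) \<subseteq> {..<n}" by (auto simp: zp)
    ultimately show ?thesis using p(1) by blast
  qed
  obtain t1 where t1: "t1 \<le> n - 1" "zero_pattern (x t1) = zero_pattern (x (Suc t1))"
    using increasing_chain_stabilises[of "\<lambda>t. zero_pattern (x t)" n] zp_mono zp_proper by blast
  define k0 where "k0 = (LEAST t. zero_pattern (x t) = zero_pattern (x (Suc t)))"
  have k0_eq: "zero_pattern (x k0) = zero_pattern (x (Suc k0))"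
    unfolding k0_def by (rule LeastI[of _ t1]) (rule t1(2))
  have k0_le: "k0 \<le> n - 1"
    using Least_le[of "\<lambda>t. zero_pattern (x t) = zero_pattern (x (Suc t))" t1] t1 by (simp add: k0_def)
  have k0_least: "\<forall>t<k0. zero_pattern (x t) \<noteq> zero_pattern (x (Suc t))"
    unfolding k0_def using not_less_Least by blast
  have step_eq: "zero_pattern (x t) = zero_pattern (x (Suc t))" if "k0 \<le> t" for t
    using that
  proof (induction t rule: dec_induct)
    case base
    show ?case by (rule k0_eq)
  next
    case (step t)
    have "zero_pattern (x (Suc (Suc t))) \<subseteq> zero_pattern (x (Suc t))"
    proof
      fix i assume "i \<in> zero_pattern (x (Suc (Suc t)))"
      then have i: "i < n" "x (Suc (Suc t)) $ i = 0" by (auto simp: zp)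
      have same: "x t $ j = 0" if "j < n" "x (Suc t) $ j = 0" for j
        using step.IH that unfolding zp by blast
      have "x (Suc t) $ i = 0"
        by (rule S.iteration_zero_pattern_stable[where x = "\<lambda>t j. x t $ j" and t = t,
              OF x_nonneg iter same i])
      then show "i \<in> zero_pattern (x (Suc t))" unfolding zp using i(1) by blast
    qed
    then show ?case using zp_mono[of "Suc t"] by blast
  qed
  have stable: "zero_pattern (x t) = zero_pattern (x k0)" if "k0 \<le> t" for t
    using that
  proof (induction t rule: dec_induct)
    case (step t)
    then show ?case using step_eq[OF step.hyps(1)] by metis
  qed simp

  \<comment> \<open>The reduced iteration\<close>
  define J where "J = {..<n} - zero_pattern (x k0)"
  have J: "J \<subseteq> {..<n}" by (auto simp: J_def)
  have p_J: "p \<in> J" using p(1) b_pos[OF p, of k0] by (simp add: J_def zp)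
  interpret R: M_splitting "card J" k "subtensor A J" "subtensor L J"
    "\<lambda>i j. P $$ (pick J i, pick J j)" "\<lambda>i. b $ pick J i"
    by (rule S.sub[OF J])
  note pick_n = pick_less(1)[OF J]
  have x_off: "x t $ j = 0" if "k0 \<le> t" "j < n" "j \<notin> J" for t j
    using stable[OF that(1)] that(2,3) unfolding J_def zp by blast
  have xm_off: "xmax $ j = 0" if "j < n" "j \<notin> J" for j
    using xm_le[OF that(1), of k0] x_off[OF _ that, of k0] xm_nonneg[OF that(1)] by simp
  note sub_x = subvec_index[OF xc J] and sub_xm = subvec_index[OF xmc J]
    and sub_b = subvec_index[OF bc J] and sub_P = submatrix_pick[OF Pc J]
  have sub_form: "tensor_form (card J) k T i (\<lambda>j. subvec v J $ j) =
      tensor_form (card J) k T i (\<lambda>j. v $ pick J j)" if "v \<in> carrier_vec n" for T i v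
    by (rule tensor_form_cong) (simp_all add: subvec_index(2)[OF that J])
  have sub_P_pow: "(submatrix P J J *\<^sub>v vec_pow v k) $ i =
      (\<Sum>j<card J. P $$ (pick J i, pick J j) * (v $ j) ^ k)"
    if "v \<in> carrier_vec (card J)" "i < card J" for v i
    unfolding mult_mat_vec_pow[OF sub_P(1) that] using that(2) by (simp add: sub_P(2))
  have iter': "(\<Sum>j<card J. P $$ (pick J i, pick J j) * (x (Suc t) $ pick J j) ^ k) =
      tensor_form (card J) k (subtensor L J) i (\<lambda>j. x t $ pick J j) + b $ pick J i"
    if t: "k0 \<le> t" and i: "i < card J" for t i
  proof -
    have "(\<Sum>j\<in>{..<n} - J. P $$ (pick J i, j) * (x (Suc t) $ j) ^ k) = 0"
      using x_off[of "Suc t"] t k by (intro sum.neutral) (auto simp: zero_power)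
    moreover have "tensor_form (card J) k (subtensor L J) i (\<lambda>j. x t $ pick J j) =
        tensor_form n k L (pick J i) (\<lambda>j. x t $ j)"
      by (rule tensor_form_pick_supported[OF J x_off[OF t]])
    ultimately show ?thesis
      using iter[OF pick_n[OF i], of t] sum_pick[OF J, of "\<lambda>j. P $$ (pick J i, j) * (x (Suc t) $ j) ^ k"]
      by simp
  qed
  have mat_iter: "submatrix P J J *\<^sub>v vec_pow (subvec (x (Suc t)) J) (m - 1) =
      tensor_vec m (card J) (subtensor L J) (subvec (x t) J) + subvec b J" if t: "k0 \<le> t" for t
  proof (rule eq_vecI)
    fix i assume "i < dim_vec (tensor_vec m (card J) (subtensor L J) (subvec (x t) J) + subvec b J)"
    then have i: "i < card J" using sub_b(1) by simp
    show "(submatrix P J J *\<^sub>v vec_pow (subvec (x (Suc t)) J) (m - 1)) $ i =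
      (tensor_vec m (card J) (subtensor L J) (subvec (x t) J) + subvec b J) $ i"
      using iter'[OF t i] i sub_b sub_P_pow[OF sub_x(1) i, of "Suc t"]
      by (simp add: m1 tensor_vec_index sub_form[OF xc] sub_x(2))
  qed (use sub_b(1) sub_P(1) in simp)

  have char: "((\<forall>t\<ge>k0. y t \<in> carrier_vec (card J) \<and> 0\<^sub>v (card J) \<le> y t) \<and> y k0 = subvec (x k0) J \<and>
      (\<forall>t\<ge>k0. submatrix P J J *\<^sub>v vec_pow (y (Suc t)) (m - 1) =
        tensor_vec m (card J) (subtensor L J) (y t) + subvec b J)) \<longleftrightarrow>
      (\<forall>t\<ge>k0. y t = subvec (x t) J)" (is "?lhs \<longleftrightarrow> ?rhs") for y
  proof
    assume y: ?lhs
    have "y t = subvec (x t) J" if "k0 \<le> t" for t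
      using that
    proof (induction t rule: dec_induct)
      case base
      show ?case using y by blast
    next
      case (step t)
      have yc: "y (Suc t) \<in> carrier_vec (card J)" and y0: "0\<^sub>v (card J) \<le> y (Suc t)"
        using y step.hyps(1) le_SucI by blast+
      have eq: "submatrix P J J *\<^sub>v vec_pow (y (Suc t)) k =
          submatrix P J J *\<^sub>v vec_pow (subvec (x (Suc t)) J) k"
      proof -
        have "submatrix P J J *\<^sub>v vec_pow (y (Suc t)) (m - 1) =
            tensor_vec m (card J) (subtensor L J) (y t) + subvec b J"
          using y step.hyps(1) by blast
        then show ?thesis using mat_iter[OF step.hyps(1)] step.IH by (simp add: m1)
      qed
      \<comment> \<open>The recursion determines only \<open>k\<close>-th powers; since
        \<open>k\<close> may be even, the roots agree only thanks to nonnegativity.\<close>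
      have "(y (Suc t) $ i) ^ k = (subvec (x (Suc t)) J $ i) ^ k" if "i < card J" for i
      proof (rule semipositive_Z_unique[where v = "\<lambda>i. (y (Suc t) $ i) ^ k"
            and w = "\<lambda>i. (subvec (x (Suc t)) J $ i) ^ k", OF R.P _ that])
        fix i assume i: "i < card J"
        show "(\<Sum>j<card J. P $$ (pick J i, pick J j) * (y (Suc t) $ j) ^ k) =
            (\<Sum>j<card J. P $$ (pick J i, pick J j) * (subvec (x (Suc t)) J $ j) ^ k)"
          unfolding sub_P_pow[OF yc i, symmetric] sub_P_pow[OF sub_x(1) i, symmetric] eq ..
      qed
      moreover have "0 \<le> y (Suc t) $ i" if "i < card J" for i
        by (rule vec_nonneg_index[OF y0 that])
      moreover have "0 \<le> subvec (x (Suc t)) J $ i" if "i < card J" for i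
        using x_nonneg[OF pick_n[OF that]] sub_x(2)[OF that] by simp
      ultimately have "y (Suc t) $ i = subvec (x (Suc t)) J $ i" if "i < card J" for i
        using that k by (metis power_eq_imp_eq_base)
      then show ?case using yc sub_x(1)[of "Suc t"] by (intro eq_vecI) auto
    qed
    then show ?rhs by blast
  next
    assume y: ?rhs
    have "0\<^sub>v (card J) \<le> subvec (x t) J" for t
      by (rule vec_leI[OF _ sub_x(1)]) (simp_all add: sub_x(2) x_nonneg pick_n)
    then show ?lhs using y sub_x(1) mat_iter by auto
  qed

  \<comment> \<open>The maximal solution of the reduced equation\<close>
  have xm_form: "tensor_form (card J) k (subtensor A J) i (\<lambda>j. xmax $ pick J j) = b $ pick J i"
    if i: "i < card J" for i
  proof -
    have "tensor_form (card J) k (subtensor A J) i (\<lambda>j. xmax $ pick J j) =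
        tensor_form n k A (pick J i) (\<lambda>j. xmax $ j)"
      by (rule tensor_form_pick_supported[OF J xm_off])
    then show ?thesis using xm_sol[OF pick_n[OF i]] by simp
  qed
  have xm_fixpt: "(\<Sum>j<card J. P $$ (pick J i, pick J j) * (xmax $ pick J j) ^ k) =
      tensor_form (card J) k (subtensor L J) i (\<lambda>j. xmax $ pick J j) + b $ pick J i"
    if i: "i < card J" for i
    using R.form_eq[OF i, of "\<lambda>j. xmax $ pick J j"] xm_form[OF i] by simp
  have xm'_sol: "nonneg_solution m (card J) (subtensor A J) (subvec b J) (subvec xmax J)"
    unfolding nonneg_solution_def
  proof (intro conjI)
    show "subvec xmax J \<in> carrier_vec (card J)" by (rule sub_xm(1))
    show "0\<^sub>v (card J) \<le> subvec xmax J"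
      by (rule vec_leI[OF _ sub_xm(1)]) (simp_all add: sub_xm(2) xm_nonneg pick_n)
    show "tensor_vec m (card J) (subtensor A J) (subvec xmax J) = subvec b J"
    proof (rule eq_vecI)
      fix i assume "i < dim_vec (subvec b J)"
      then have i: "i < card J" using sub_b(1) by simp
      then show "tensor_vec m (card J) (subtensor A J) (subvec xmax J) $ i = subvec b J $ i"
        using xm_form[OF i] sub_b(2)[OF i]
        by (simp add: tensor_vec_index m1 sub_form[OF xmc])
    qed (use sub_b(1) in \<open>simp add: tensor_vec_def\<close>)
  qed
  \<comment> \<open>Extending \<open>y\<close> by zeros need not solve the original equation, so
    maximality of \<open>xmax\<close> does not apply to it. Instead \<open>y\<close> is kept below
    all restricted iterates, from \<open>t = 0\<close> on, and the limit is taken.\<close>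
  have xm'_max: "y \<le> subvec xmax J"
    if y: "nonneg_solution m (card J) (subtensor A J) (subvec b J) y" for y
  proof -
    have yc: "y \<in> carrier_vec (card J)" using y by (simp add: nonneg_solution_def)
    have y0: "0 \<le> y $ i" if "i < card J" for i
      using y that vec_nonneg_index by (auto simp: nonneg_solution_def)
    have y_sol: "tensor_form (card J) k (subtensor A J) i (\<lambda>j. y $ j) = b $ pick J i"
      if "i < card J" for i
      using y that tensor_vec_index[OF that, of m "subtensor A J" y] sub_b(2)[OF that]
      by (simp add: nonneg_solution_def m1)
    \<comment> \<open>Passing to the subtensor drops nonpositive contributions only, so the
      restricted \<open>x 0\<close> remains an admissible comparison vector for the reduced
      equation.\<close>
    have A0: "tensor_form n k A (pick J i) (\<lambda>j. x 0 $ j) \<le>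
        tensor_form (card J) k (subtensor A J) i (\<lambda>j. x 0 $ pick J j)" if i: "i < card J" for i
      unfolding R.form_eq[OF i] S.form_eq[OF pick_n[OF i]]
      by (intro diff_mono semipositive_Z_pick_le[OF S.P J i] tensor_form_pick_le[OF J i]
          S.L[OF pick_n[OF i]] zero_le_power x_nonneg)
    have y_le: "y $ i \<le> x t $ pick J i" if "i < card J" for t i
    proof (rule R.iteration_lower[where y = "\<lambda>j. y $ j" and x = "\<lambda>t j. x t $ pick J j", OF _ _ _ _ _ that])
      show "(\<Sum>j<card J. P $$ (pick J i, pick J j) * (y $ j) ^ k) \<le>
          tensor_form (card J) k (subtensor L J) i (\<lambda>j. y $ j) + b $ pick J i" if "i < card J" for i
        using R.form_eq[OF that, of "\<lambda>j. y $ j"] y_sol[OF that] by simp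
      show "tensor_form (card J) k (subtensor L J) i (\<lambda>j. x t $ pick J j) + b $ pick J i \<le>
          (\<Sum>j<card J. P $$ (pick J i, pick J j) * (x (Suc t) $ pick J j) ^ k)" if i: "i < card J" for t i
      proof -
        have "tensor_form (card J) k (subtensor L J) i (\<lambda>j. x t $ pick J j) \<le>
            tensor_form n k L (pick J i) (\<lambda>j. x t $ j)"
          by (intro tensor_form_pick_le[OF J i] S.L[OF pick_n[OF i]] x_nonneg)
        moreover have "(\<Sum>j<n. P $$ (pick J i, j) * (x (Suc t) $ j) ^ k) \<le>
            (\<Sum>j<card J. P $$ (pick J i, pick J j) * (x (Suc t) $ pick J j) ^ k)"
          by (intro semipositive_Z_pick_le[OF S.P J i] zero_le_power x_nonneg)
        ultimately show ?thesis using iter[OF pick_n[OF i], of t] by linarith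
      qed
      show "y $ i \<le> x 0 $ pick J i" if "i < card J" for i
      proof (rule R.comparison[where f = "\<lambda>j. y $ j" and g = "\<lambda>j. x 0 $ pick J j", OF _ y0 _ that])
        fix i assume i: "i < card J"
        show "0 < x 0 $ pick J i \<and>
            0 < tensor_form (card J) k (subtensor A J) i (\<lambda>j. x 0 $ pick J j)"
          using start(1,2)[OF pick_n[OF i]] A0[OF i] by simp
        show "tensor_form (card J) k (subtensor A J) i (\<lambda>j. y $ j) \<le>
            tensor_form (card J) k (subtensor A J) i (\<lambda>j. x 0 $ pick J j)"
          using start(3)[OF pick_n[OF i]] A0[OF i] y_sol[OF i] by simp
      qed
    qed (simp_all add: y0 x_nonneg pick_n)
    have "y $ i \<le> xmax $ pick J i" if "i < card J" for i
      using x_lim[OF pick_n[OF that]] by (rule LIMSEQ_le_const) (auto intro: y_le[OF that])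
    then show ?thesis by (intro vec_leI[OF yc sub_xm(1)]) (simp add: sub_xm(2))
  qed
  have max_iff: "maximal_nonneg_solution m (card J) (subtensor A J) (subvec b J) y \<longleftrightarrow> y = subvec xmax J" for y
    unfolding maximal_nonneg_solution_def using xm'_sol xm'_max by (metis order_antisym)

  have lin_iff: "linearly_convergent_from 0 x xmax \<longleftrightarrow>
      linearly_convergent_from k0 (\<lambda>t. subvec (x t) J) (subvec xmax J)"
  proof (rule linearly_convergent_from_iff)
    fix t assume "k0 \<le> t"
    then show "vnorm (x t - xmax) = vnorm (subvec (x t) J - subvec xmax J)"
      using x_off xm_off by (intro vnorm_subvec[OF xc xmc J, symmetric]) auto
  qed

  have zp_b: "zero_pattern (x k0) \<subseteq> {i. i < n \<and> b $ i = 0}"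
  proof
    fix i assume "i \<in> zero_pattern (x k0)"
    then have i: "i < n" "x k0 $ i = 0" by (auto simp: zp)
    then have "\<not> 0 < b $ i" using b_pos[OF i(1), of k0] by auto
    then show "i \<in> {i. i < n \<and> b $ i = 0}" using i(1) b_nonneg[OF i(1)] by simp
  qed

  \<comment> \<open>Linear convergence under the four conditions\<close>
  have conv: "linearly_convergent_from k0 (\<lambda>t. subvec (x t) J) (subvec xmax J)"
    if pos: "vec_less (0\<^sub>v (card J)) (subvec xmax J)" and noniso: "\<And>R. \<not> R.isolated R"
  proof -
    have xm_pos: "0 < xmax $ pick J i" if "i < card J" for i
      using pos that sub_xm by (auto simp: vec_less_def)
    \<comment> \<open>The sequence is shifted by \<open>k0\<close>, from where the reduced recursion
      is exact.\<close>
    have "\<exists>c r. 0 < c \<and> 0 < r \<and> r < 1 \<and>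
        (\<forall>t. \<forall>i<card J. x (k0 + t) $ pick J i - xmax $ pick J i \<le> c * r ^ t)"
    proof (rule R.linear_convergence[where z = "\<lambda>i. xmax $ pick J i" and x = "\<lambda>t i. x (k0 + t) $ pick J i"])
      show "(\<Sum>j<card J. P $$ (pick J i, pick J j) * (xmax $ pick J j) ^ k) =
          tensor_form (card J) k (subtensor L J) i (\<lambda>j. xmax $ pick J j) + b $ pick J i" if "i < card J" for i
        by (rule xm_fixpt[OF that])
      show "(\<Sum>j<card J. P $$ (pick J i, pick J j) * (x (k0 + Suc t) $ pick J j) ^ k) =
          tensor_form (card J) k (subtensor L J) i (\<lambda>j. x (k0 + t) $ pick J j) + b $ pick J i" if i: "i < card J" for t i
        using iter'[OF _ i, of "k0 + t"] by simp
      show "xmax $ pick J i \<le> x (k0 + t) $ pick J i" if "i < card J" for t i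
        by (rule xm_le[OF pick_n[OF that]])
    qed (simp_all add: xm_pos noniso)
    then obtain c r where cr: "0 < c" "0 < r" "r < 1"
      "\<And>t i. i < card J \<Longrightarrow> x (k0 + t) $ pick J i - xmax $ pick J i \<le> c * r ^ t"
      by blast
    show ?thesis
    proof (rule linearly_convergent_fromI[OF cr(1-3) sub_x(1) sub_xm(1)])
      fix t i assume i: "i < card J"
      show "\<bar>subvec (x (k0 + t)) J $ i - subvec xmax J $ i\<bar> \<le> c * r ^ t"
        using cr(4)[OF i, of t] xm_le[OF pick_n[OF i], of "k0 + t"]
        by (simp add: sub_x(2)[OF i] sub_xm(2)[OF i])
    qed
  qed

  have noniso: "\<not> R.isolated R"
    if pos: "vec_less (0\<^sub>v (card J)) (subvec xmax J)"
      and cond: "vec_less (0\<^sub>v (card J)) (the (mat_inverse (submatrix P J J)) *\<^sub>v subvec b J) \<or>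
        irreducible_mat (the (mat_inverse (submatrix P J J)) *
          tensor_mat m (card J) (semi_symmetric m (subtensor L J)) (ones_vec (card J))) \<or>
        ((\<forall>i<card J. submatrix P J J $$ (i, i) = subtensor A J (replicate m i)) \<and>
         (strictly_upper_triangular (tensor_mat m (card J) (semi_symmetric m
            (\<lambda>js. diagonal_part (subtensor A J) js - subtensor A J js)) (ones_vec (card J))) \<or>
          strictly_lower_triangular (tensor_mat m (card J) (semi_symmetric m
            (\<lambda>js. diagonal_part (subtensor A J) js - subtensor A J js)) (ones_vec (card J))))) \<or>
        (\<forall>i\<in>{i. i < n \<and> b $ i = 0} \<inter> J. \<exists>js. length js = m - 1 \<and> set js \<subseteq> J \<and> A (i # js) \<noteq> 0 \<and>
          (\<exists>j\<in>set js. j \<notin> {i. i < n \<and> b $ i = 0}))" for R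
    using cond
  proof (elim disjE conjE)
    assume inv_pos: "vec_less (0\<^sub>v (card J)) (the (mat_inverse (submatrix P J J)) *\<^sub>v subvec b J)"
    show ?thesis by (rule R.not_isolated_if_inverse_pos[OF sub_P sub_b inv_pos])
  next
    assume irr: "irreducible_mat (the (mat_inverse (submatrix P J J)) *
      tensor_mat m (card J) (semi_symmetric m (subtensor L J)) (ones_vec (card J)))"
    \<comment> \<open>A positive entry of \<open>b\<close> survives in the reduced problem, so an
      isolated set cannot exhaust its indices.\<close>
    have "p \<in> pick J ` {..<card J}"
      using bij_betw_pick[of J] p_J J finite_subset by (auto simp: bij_betw_def)
    then obtain q where "q < card J" "0 < b $ pick J q" using p(2) by auto
    then show ?thesis by (rule R.not_isolated_if_irreducible[OF sub_P _ _ irr[unfolded m], rotated 2])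
  next
    assume diag: "\<forall>i<card J. submatrix P J J $$ (i, i) = subtensor A J (replicate m i)"
    have xm_pos: "0 < xmax $ pick J i" if "i < card J" for i
      using pos that sub_xm by (auto simp: vec_less_def)

    have diag': "P $$ (pick J i, pick J i) = subtensor A J (replicate (Suc k) i)" if "i < card J" for i
      using diag that sub_P(2)[OF that that] by (simp add: m)
    note tri = R.not_isolated_if_triangular[where z = "\<lambda>i. xmax $ pick J i", OF xm_pos xm_fixpt diag', folded m]
    {
      assume "strictly_upper_triangular (tensor_mat m (card J) (semi_symmetric m
            (\<lambda>js. diagonal_part (subtensor A J) js - subtensor A J js)) (ones_vec (card J)))"
      then show ?thesis using tri by blast
    }
    {
      assume "strictly_lower_triangular (tensor_mat m (card J) (semi_symmetric m
            (\<lambda>js. diagonal_part (subtensor A J) js - subtensor A J js)) (ones_vec (card J)))"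
      then show ?thesis using tri by blast
    }
  next
    assume link: "\<forall>i\<in>{i. i < n \<and> b $ i = 0} \<inter> J. \<exists>js. length js = m - 1 \<and> set js \<subseteq> J \<and>
      A (i # js) \<noteq> 0 \<and> (\<exists>j\<in>set js. j \<notin> {i. i < n \<and> b $ i = 0})"
    show ?thesis
    proof (rule R.not_isolated_if_linked)
      fix i assume i: "i < card J" "b $ pick J i = 0"
      then have "pick J i \<in> {i. i < n \<and> b $ i = 0} \<inter> J" using pick_less[OF J i(1)] by simp
      then obtain js j where js: "length js = k" "set js \<subseteq> J" "A (pick J i # js) \<noteq> 0"
        "j \<in> set js" "j \<notin> {i. i < n \<and> b $ i = 0}"
        using link unfolding m1 by blast
      have "js \<in> {js \<in> index_lists n k. set js \<subseteq> J}" using js(1,2) J by (auto simp: index_lists_def)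
      then obtain ls where ls: "ls \<in> index_lists (card J) k" "js = map (pick J) ls"
        using map_pick_index_lists_image[OF J, of k] by blast
      then obtain q where "q \<in> set ls" "j = pick J q" using js(4) by auto
      moreover have "j < n" using js(2,4) J by auto
      ultimately show "\<exists>js\<in>index_lists (card J) k. subtensor A J (i # js) \<noteq> 0 \<and>
          (\<exists>j\<in>set js. b $ pick J j \<noteq> 0)"
        using js(3,5) ls by (intro bexI[of _ ls]) (auto simp: subtensor_def)
    qed
  qed

  show ?thesis
  proof (rule exI[of _ k0], unfold Let_def, fold J_def L_def, intro conjI)
    show "k0 \<le> n - 1" by (rule k0_le)
    show "zero_pattern (x k0) = zero_pattern (x (Suc k0))" by (rule k0_eq)
    show "\<forall>t<k0. zero_pattern (x t) \<noteq> zero_pattern (x (Suc t))" by (rule k0_least)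
    show "\<forall>t\<ge>k0. zero_pattern (x t) = zero_pattern (x k0)" using stable by blast
    show "zero_pattern (x k0) \<subseteq> {i. i < n \<and> b $ i = 0}" by (rule zp_b)
  qed (rule allI, rule char, rule allI, rule max_iff, rule lin_iff, rule impI, erule conjE,
      rule conv, assumption, rule noniso, assumption, assumption)
qed

end
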